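(* Let $(f_n)_{n\in\mathbb N}$ be a sequence of continuous functions $\mathbb R\to\mathbb R$ with pointwise limit $f$. Then $\exists^2$ computes, from the sequence $(f_n)_{n\in\mathbb N}$, a gauge representation for $f$, i.e.\ a functional which on input $\varepsilon>0$ yields an $\varepsilon$-gauge for $f$.
   Context: Computability means Kleene's higher-order computability via S1–S9. Kleene's quantifier $\exists^2:\mathbb N^{\mathbb N}\to\{0,1\}$ satisfies $\exists^2(f)=0\iff(\exists n)(f(n)=0)$. For $\varepsilon>0$, an $\varepsilon$-gauge for $f:\mathbb R\to\mathbb R$ is a function $\delta:\mathbb R\to\mathbb R^+$ such that for all $x,y\in\mathbb R$, $|x-y|<\min(\delta(x),\delta(y))$ implies $|f(x)-f(y)|<\varepsilon$. *)

theory Defs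
  imports "HOL-Analysis.Analysis" "HOL-Library.Nat_Bijection" "HOL-Library.Countable"
begin

section \<open>Kleene's schemes S1--S9\<close>

text \<open>
  The arguments of a computation are objects of pure type 0, 1 or 2. This fragment of S1--S9 is
  closed under subcomputations: the only scheme that puts a new higher-type object on the argument
  list is S8, and for a type-2 functional that object has type 0.
\<close>

datatype obj = T0 nat | T1 "nat \<Rightarrow> nat" | T2 "(nat \<Rightarrow> nat) \<Rightarrow> nat"

text \<open>
  \<open>kleene e as v\<close> says that \<open>{e}(as)\<close> is defined with value \<open>v\<close>. Indices are coded sequences of
  numbers whose first entry is the number of the scheme. Argument lists mix the types, and S6
  allows any permutation of the list. An index does not record the signature of the argument list:
  an index is simply undefined on lists to which its scheme does not apply.
  In S9, \<open>m\<close> says how many of the arguments are passed on to the index that is evaluated.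
\<close>

inductive kleene :: "nat \<Rightarrow> obj list \<Rightarrow> nat \<Rightarrow> bool" where
  S1: "kleene (list_encode [1]) (T0 x # as) (Suc x)"
| S2: "kleene (list_encode [2, q]) as q"
| S3: "kleene (list_encode [3]) (T0 x # as) x"
| S4: "kleene d as u \<Longrightarrow> kleene c (T0 u # as) v \<Longrightarrow>
       kleene (list_encode [4, c, d]) as v"
| S5_0: "kleene c as v \<Longrightarrow>
       kleene (list_encode [5, c, d]) (T0 0 # as) v"
| S5_Suc: "kleene (list_encode [5, c, d]) (T0 x # as) u \<Longrightarrow>
       kleene d (T0 x # T0 u # as) v \<Longrightarrow>
       kleene (list_encode [5, c, d]) (T0 (Suc x) # as) v"
| S6: "length p = length as \<Longrightarrow> set p = {..<length as} \<Longrightarrow>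
       kleene d (map (\<lambda>i. as ! i) p) v \<Longrightarrow>
       kleene (list_encode [6, d, list_encode p]) as v"
| S7: "kleene (list_encode [7]) (T1 f # T0 x # as) (f x)"
| S8: "(\<And>x. kleene d (T0 x # T2 F # as) (g x)) \<Longrightarrow>
       kleene (list_encode [8, d]) (T2 F # as) (F g)"
| S9: "m \<le> length as \<Longrightarrow> kleene x (take m as) v \<Longrightarrow>
       kleene (list_encode [9, m]) (T0 x # as) v"

lemma kleene_deterministic:
  assumes "kleene e as v" and "kleene e as w"
  shows "v = w"
proof -
  have inj: "list_encode xs = list_encode ys \<longleftrightarrow> xs = ys" for xs ys
    by (metis list_encode_inverse)
  have "kleene e as v \<Longrightarrow> kleene e as w \<Longrightarrow> v = w" for w
  proof (induction arbitrary: w rule: kleene.induct)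
    case (S1 x as)
    from S1 show ?case
      by cases (auto simp: inj simp del: list_encode.simps)
  next
    case (S2 q as)
    from S2 show ?case
      by cases (auto simp: inj simp del: list_encode.simps)
  next
    case (S3 x as)
    from S3 show ?case
      by cases (auto simp: inj simp del: list_encode.simps)
  next
    case (S4 d as u c v)
    from S4.prems show ?case
      by cases (auto simp: inj simp del: list_encode.simps dest: S4.IH)
  next
    case (S5_0 c as v d)
    from S5_0.prems show ?case
      by cases (auto simp: inj simp del: list_encode.simps dest: S5_0.IH)
  next
    case (S5_Suc c d x as u v)
    from S5_Suc.prems show ?case
      by cases (auto simp: inj simp del: list_encode.simps dest: S5_Suc.IH)
  next
    case (S6 p as d v)
    from S6.prems show ?case
      by cases (auto simp: inj simp del: list_encode.simps dest: S6.IH)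
  next
    case (S7 f x as)
    from S7 show ?case
      by cases (auto simp: inj simp del: list_encode.simps)
  next
    case (S8 d F as g)
    from S8.prems obtain g' where g': "w = F g'" "\<And>x. kleene d (T0 x # T2 F # as) (g' x)"
      by cases (auto simp: inj simp del: list_encode.simps)
    then have "g x = g' x" for x using S8.IH by blast
    then have "g = g'" by (rule ext)
    then show ?case using g' by simp
  next
    case (S9 m as x v)
    from S9.prems show ?case
      by cases (auto simp: inj simp del: list_encode.simps dest: S9.IH)
  qed
  then show ?thesis using assms by blast
qed

definition exists2 :: "(nat \<Rightarrow> nat) \<Rightarrow> nat" where
  "exists2 f = (if \<exists>n. f n = 0 then 0 else 1)"


section \<open>Real numbers and real functions as higher-type objects\<close>

text \<open>
  A real number is given by a fast converging Cauchy sequence of (coded) rationals.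
\<close>

definition real_rep :: "(nat \<Rightarrow> nat) \<Rightarrow> real \<Rightarrow> bool" where
  "real_rep \<alpha> x \<longleftrightarrow>
     (\<forall>n i. \<bar>nat_to_rat_surj (\<alpha> n) - nat_to_rat_surj (\<alpha> (n + i))\<bar> < 1 / 2 ^ n) \<and>
     (\<lambda>n. real_of_rat (nat_to_rat_surj (\<alpha> n))) \<longlonglongrightarrow> x"

text \<open>
  A function on the reals is given by a total operator on sequences that maps every
  representation of \<open>x\<close> to a representation of \<open>h x\<close>; in particular it respects equality of reals.
\<close>

definition fun_rep :: "((nat \<Rightarrow> nat) \<Rightarrow> nat \<Rightarrow> nat) \<Rightarrow> (real \<Rightarrow> real) \<Rightarrow> bool" where
  "fun_rep \<Phi> h \<longleftrightarrow> (\<forall>\<alpha> x. real_rep \<alpha> x \<longrightarrow> real_rep (\<Phi> \<alpha>) (h x))"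

text \<open>
  A sequence of functions is given by a single object of pure type 2: on the sequence
  \<open>\<langle>n, k\<rangle>, \<alpha> 0, \<alpha> 1, \<dots>\<close> it returns the \<open>k\<close>-th entry of the image of \<open>\<alpha>\<close> under the
  operator for the \<open>n\<close>-th function.
\<close>

definition seq_rep :: "((nat \<Rightarrow> nat) \<Rightarrow> nat) \<Rightarrow> (nat \<Rightarrow> real \<Rightarrow> real) \<Rightarrow> bool" where
  "seq_rep \<Psi> fs \<longleftrightarrow>
     (\<forall>n. fun_rep (\<lambda>\<alpha> k. \<Psi> (case_nat (prod_encode (n, k)) \<alpha>)) (fs n))"


section \<open>Gauges\<close>

definition eps_gauge :: "real \<Rightarrow> (real \<Rightarrow> real) \<Rightarrow> (real \<Rightarrow> real) \<Rightarrow> bool" where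
  "eps_gauge \<epsilon> f \<delta> \<longleftrightarrow>
     (\<forall>x. \<delta> x > 0) \<and>
     (\<forall>x y. \<bar>x - y\<bar> < min (\<delta> x) (\<delta> y) \<longrightarrow> \<bar>f x - f y\<bar> < \<epsilon>)"

definition gauge_representation :: "(real \<Rightarrow> real) \<Rightarrow> (real \<Rightarrow> real \<Rightarrow> real) \<Rightarrow> bool" where
  "gauge_representation f \<Delta> \<longleftrightarrow> (\<forall>\<epsilon>>0. eps_gauge \<epsilon> f (\<Delta> \<epsilon>))"

text \<open>
  The index \<open>e\<close> computes, from \<open>\<exists>\<^sup>2\<close> and the sequence \<open>fs\<close>, the functional that maps a positive
  real \<open>\<epsilon>\<close> to the function \<open>\<Delta> \<epsilon>\<close>. The functional depends on the real \<open>\<epsilon>\<close> and on the functions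
  \<open>fs\<close>, but not on the objects \<open>\<eta>\<close> and \<open>\<Psi>\<close> representing them. The operator \<open>\<Phi>\<close> that is obtained
  for \<open>\<Delta> \<epsilon>\<close> is total, so the computation has to converge on every sequence \<open>\<alpha>\<close>.
\<close>

definition exists2_computes_from ::
  "nat \<Rightarrow> (nat \<Rightarrow> real \<Rightarrow> real) \<Rightarrow> (real \<Rightarrow> real \<Rightarrow> real) \<Rightarrow> bool" where
  "exists2_computes_from e fs \<Delta> \<longleftrightarrow>
     (\<forall>\<Psi> \<epsilon> \<eta>. seq_rep \<Psi> fs \<longrightarrow> \<epsilon> > 0 \<longrightarrow> real_rep \<eta> \<epsilon> \<longrightarrow>
        (\<exists>\<Phi>. fun_rep \<Phi> (\<Delta> \<epsilon>) \<and>
             (\<forall>\<alpha> k. kleene e [T0 k, T1 \<alpha>, T1 \<eta>, T2 \<Psi>, T2 exists2] (\<Phi> \<alpha> k))))"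

end

theory Submission
  imports Defs
begin

text \<open>
  For a point \<open>x\<close> let \<open>N\<close> be the least stage with \<open>\<bar>fs m x - fs N x\<bar> \<le> \<epsilon> / 4\<close> for all \<open>m \<ge> N\<close>.
  The points settled at a given stage form a closed set, so some ball around \<open>x\<close> misses the sets
  of all smaller stages, and by continuity \<open>fs N\<close> varies by at most \<open>\<epsilon> / 4\<close> on some ball. Points
  within each other's balls then have the same stage, whence \<open>f\<close> differs by at most \<open>3 \<epsilon> / 4\<close>.
  By continuity it suffices to look at the rational points of a ball, so that the condition on a
  radius \<open>1 / 2 ^ k\<close> is arithmetical in the representations and \<open>\<exists>\<^sup>2\<close> decides it. To compute the
  gauge with the least such \<open>k\<close> no unbounded search is needed: its \<open>n\<close>-th approximation is \<open>0\<close>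
  unless \<open>k < n + 2\<close>.
\<close>

section \<open>Closure properties of the computable functionals\<close>

type_synonym 'r functional =
  "nat list \<Rightarrow> (nat \<Rightarrow> nat) \<Rightarrow> (nat \<Rightarrow> nat) \<Rightarrow> ((nat \<Rightarrow> nat) \<Rightarrow> nat) \<Rightarrow> 'r"

text \<open>The numbers stand in front because S4 and S5 add new numbers there: a bound variable is
  \<open>hd ys\<close>, and the surrounding context is \<open>tl ys\<close>.\<close>

definition arguments :: "obj list functional" where
  "arguments xs \<alpha> \<eta> \<Psi> = map T0 xs @ [T1 \<alpha>, T1 \<eta>, T2 \<Psi>, T2 exists2]"

text \<open>One index serves all arguments of the given shape and converges on all of them, whether
  or not they represent anything. S8 relies on such totality, since it applies a functional to a
  total function.\<close>

definition computable :: "nat \<Rightarrow> nat functional \<Rightarrow> bool" where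
  "computable n F \<longleftrightarrow>
     (\<exists>e. \<forall>xs \<alpha> \<eta> \<Psi>. length xs = n \<longrightarrow> kleene e (arguments xs \<alpha> \<eta> \<Psi>) (F xs \<alpha> \<eta> \<Psi>))"

lemma computableI:
  assumes "\<And>xs \<alpha> \<eta> \<Psi>. length xs = n \<Longrightarrow> kleene e (arguments xs \<alpha> \<eta> \<Psi>) (F xs \<alpha> \<eta> \<Psi>)"
  shows "computable n F"
  using assms unfolding computable_def by blast

lemma computableE:
  assumes "computable n F"
  obtains e where
    "\<And>xs \<alpha> \<eta> \<Psi>. length xs = n \<Longrightarrow> kleene e (arguments xs \<alpha> \<eta> \<Psi>) (F xs \<alpha> \<eta> \<Psi>)"
  using assms unfolding computable_def by blast

lemma arguments_Cons: "arguments (x # xs) \<alpha> \<eta> \<Psi> = T0 x # arguments xs \<alpha> \<eta> \<Psi>"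
  by (simp add: arguments_def)

section \<open>Rearranging the argument list\<close>

lemma kleene_move_front:
  obtains e' where "\<And>us b vs v. length us = i \<Longrightarrow> length vs = j \<Longrightarrow>
    kleene e (b # us @ vs) v \<Longrightarrow> kleene e' (us @ b # vs) v"
proof
  \<comment> \<open>S6 passes on the arguments in the order \<open>?p\<close>: position
    \<open>i\<close> first, the others as before. The permutation depends only on the lengths, so
    one index serves all lists of this shape.\<close>
  let ?p = "i # [0..<i] @ [Suc i..<Suc (i + j)]"
  fix us vs :: "obj list" and b v
  assume len: "length us = i" "length vs = j" and e: "kleene e (b # us @ vs) v"
  have "map ((!) (us @ b # vs)) [0..<i] = us"
    using len by (auto intro!: nth_equalityI simp: nth_append)
  moreover have "map ((!) (us @ b # vs)) [Suc i..<Suc (i + j)] = vs"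
    using len by (auto intro!: nth_equalityI simp: nth_append simp del: upt_Suc)
  ultimately have "map ((!) (us @ b # vs)) ?p = b # us @ vs"
    using len by (simp add: nth_append del: upt_Suc)
  moreover have "set ?p = {..<length (us @ b # vs)}"
    using len by (auto simp del: upt_Suc)
  ultimately show "kleene (list_encode [6, e, list_encode ?p]) (us @ b # vs) v"
    using e len by (intro S6) (auto simp del: upt_Suc)
qed

lemma kleene_move_back:
  obtains e' where "\<And>us b vs v. length us = i \<Longrightarrow> length vs = j \<Longrightarrow>
    kleene e (us @ b # vs) v \<Longrightarrow> kleene e' (b # us @ vs) v"
proof
  let ?p = "[1..<Suc i] @ 0 # [Suc i..<Suc (i + j)]"
  fix us vs :: "obj list" and b v
  assume len: "length us = i" "length vs = j" and e: "kleene e (us @ b # vs) v"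
  have "map ((!) (b # us @ vs)) [1..<Suc i] = us"
    using len by (auto intro!: nth_equalityI simp: nth_append simp del: upt_Suc)
  moreover have "map ((!) (b # us @ vs)) [Suc i..<Suc (i + j)] = vs"
    using len by (auto intro!: nth_equalityI simp: nth_append simp del: upt_Suc)
  ultimately have "map ((!) (b # us @ vs)) ?p = us @ b # vs"
    using len by (simp del: upt_Suc)
  moreover have "set ?p = {..<length (b # us @ vs)}"
    using len by (auto simp del: upt_Suc)
  ultimately show "kleene (list_encode [6, e, list_encode ?p]) (b # us @ vs) v"
    using e len by (intro S6) (auto simp del: upt_Suc)
qed

section \<open>Constants, composition and primitive recursion\<close>

lemma computable_const: "computable n (\<lambda>xs \<alpha> \<eta> \<Psi>. c)"
  by (rule computableI, rule S2)

lemma computable_hd: "computable (Suc n) (\<lambda>xs \<alpha> \<eta> \<Psi>. hd xs)"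
proof (rule computableI)
  fix xs :: "nat list" and \<alpha> \<eta> \<Psi>
  assume "length xs = Suc n"
  then show "kleene (list_encode [3]) (arguments xs \<alpha> \<eta> \<Psi>) (hd xs)"
    by (cases xs) (auto simp: arguments_Cons intro: S3 simp del: list_encode.simps)
qed

text \<open>S4 puts the value of \<open>G\<close> in front of the context. Later operations thus
  need treatment only where their argument is the first number of the list.\<close>

lemma computable_let:
  assumes "computable n G"
    and "computable (Suc n) (\<lambda>ys \<alpha> \<eta> \<Psi>. F (hd ys) (tl ys) \<alpha> \<eta> \<Psi>)"
  shows "computable n (\<lambda>xs \<alpha> \<eta> \<Psi>. F (G xs \<alpha> \<eta> \<Psi>) xs \<alpha> \<eta> \<Psi>)"
proof -
  obtain d where d: "\<And>xs \<alpha> \<eta> \<Psi>. length xs = n \<Longrightarrow>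
      kleene d (arguments xs \<alpha> \<eta> \<Psi>) (G xs \<alpha> \<eta> \<Psi>)"
    using assms(1) by (rule computableE) blast
  obtain c where c: "\<And>ys \<alpha> \<eta> \<Psi>. length ys = Suc n \<Longrightarrow>
      kleene c (arguments ys \<alpha> \<eta> \<Psi>) (F (hd ys) (tl ys) \<alpha> \<eta> \<Psi>)"
    using assms(2) by (rule computableE) blast
  have "kleene (list_encode [4, c, d]) (arguments xs \<alpha> \<eta> \<Psi>) (F (G xs \<alpha> \<eta> \<Psi>) xs \<alpha> \<eta> \<Psi>)"
    if "length xs = n" for xs \<alpha> \<eta> \<Psi>
    using d[OF that] c[of "G xs \<alpha> \<eta> \<Psi> # xs"] that
    by (intro S4) (auto simp: arguments_Cons)
  then show ?thesis by (rule computableI)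
qed

lemma computable_Suc:
  assumes "computable n F"
  shows "computable n (\<lambda>xs \<alpha> \<eta> \<Psi>. Suc (F xs \<alpha> \<eta> \<Psi>))"
  using assms
proof (rule computable_let)
  have "kleene (list_encode [1]) (arguments ys \<alpha> \<eta> \<Psi>) (Suc (hd ys))"
    if "length ys = Suc n" for ys \<alpha> \<eta> \<Psi>
    using that by (cases ys) (auto simp: arguments_Cons intro: S1 simp del: list_encode.simps One_nat_def)
  then show "computable (Suc n) (\<lambda>ys \<alpha> \<eta> \<Psi>. Suc (hd ys))" by (rule computableI)
qed

text \<open>
  No scheme drops an argument. A primitive recursion that starts from the desired value and
  never changes it does so.
\<close>

lemma computable_weaken:
  assumes "computable n F"
  shows "computable (Suc n) (\<lambda>ys. F (tl ys))"
proof -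
  obtain c where c: "\<And>xs \<alpha> \<eta> \<Psi>. length xs = n \<Longrightarrow>
      kleene c (arguments xs \<alpha> \<eta> \<Psi>) (F xs \<alpha> \<eta> \<Psi>)"
    using assms by (rule computableE) blast
  \<comment> \<open>In the recursion step of S5 the counter precedes the previous value. So
    \<open>d\<close> is S3 shifted past one argument: it returns the previous value.\<close>
  obtain d where d: "\<And>us b vs v. length us = 1 \<Longrightarrow> length vs = n + 4 \<Longrightarrow>
      kleene (list_encode [3]) (b # us @ vs) v \<Longrightarrow> kleene d (us @ b # vs) v"
    by (rule kleene_move_front) blast
  have rec: "kleene (list_encode [5, c, d]) (T0 x # arguments xs \<alpha> \<eta> \<Psi>) (F xs \<alpha> \<eta> \<Psi>)"
    if len: "length xs = n" for x xs \<alpha> \<eta> \<Psi>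
  proof (induction x)
    case 0
    show ?case by (rule S5_0) (rule c[OF len])
  next
    case (Suc x)
    have "kleene d ([T0 x] @ T0 (F xs \<alpha> \<eta> \<Psi>) # arguments xs \<alpha> \<eta> \<Psi>) (F xs \<alpha> \<eta> \<Psi>)"
      by (rule d) (auto simp: arguments_def len intro: S3 simp del: list_encode.simps)
    then show ?case using Suc by (auto intro: S5_Suc simp del: list_encode.simps)
  qed
  have "kleene (list_encode [5, c, d]) (arguments ys \<alpha> \<eta> \<Psi>) (F (tl ys) \<alpha> \<eta> \<Psi>)"
    if "length ys = Suc n" for ys \<alpha> \<eta> \<Psi>
    using that rec by (cases ys) (auto simp: arguments_Cons simp del: list_encode.simps)
  then show ?thesis by (rule computableI)
qed

text \<open>Weakening ignores the front number, which is then moved to second place. This serves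
  recursion steps that use the counter but not the previous value.\<close>

lemma computable_drop_second:
  assumes "computable (Suc n) (\<lambda>ys \<alpha> \<eta> \<Psi>. F (hd ys) (tl ys) \<alpha> \<eta> \<Psi>)"
  shows "computable (Suc (Suc n)) (\<lambda>ys \<alpha> \<eta> \<Psi>. F (hd ys) (tl (tl ys)) \<alpha> \<eta> \<Psi>)"
proof -
  obtain d where d: "\<And>ys \<alpha> \<eta> \<Psi>. length ys = Suc (Suc n) \<Longrightarrow>
      kleene d (arguments ys \<alpha> \<eta> \<Psi>) (F (hd (tl ys)) (tl (tl ys)) \<alpha> \<eta> \<Psi>)"
    using computable_weaken[OF assms] by (rule computableE) blast
  obtain e where e: "\<And>us b vs v. length us = 1 \<Longrightarrow> length vs = n + 4 \<Longrightarrow>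
      kleene d (b # us @ vs) v \<Longrightarrow> kleene e (us @ b # vs) v"
    by (rule kleene_move_front) blast
  have "kleene e (arguments ys \<alpha> \<eta> \<Psi>) (F (hd ys) (tl (tl ys)) \<alpha> \<eta> \<Psi>)"
    if len: "length ys = Suc (Suc n)" for ys \<alpha> \<eta> \<Psi>
  proof -
    obtain x y xs where ys: "ys = x # y # xs" and xs: "length xs = n"
      using len by (auto simp: length_Suc_conv)
    show ?thesis
      using e[of "[T0 x]" "arguments xs \<alpha> \<eta> \<Psi>" "T0 y"] d[of "y # x # xs" \<alpha> \<eta> \<Psi>] xs
      by (simp add: ys arguments_def)
  qed
  then show ?thesis by (rule computableI)
qed

lemma computable_rec:
  assumes "computable n B"
    and "computable (Suc (Suc n)) (\<lambda>ys \<alpha> \<eta> \<Psi>. D (hd ys) (hd (tl ys)) (tl (tl ys)) \<alpha> \<eta> \<Psi>)"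
    and "computable n N"
  shows "computable n (\<lambda>xs \<alpha> \<eta> \<Psi>.
    rec_nat (B xs \<alpha> \<eta> \<Psi>) (\<lambda>x u. D x u xs \<alpha> \<eta> \<Psi>) (N xs \<alpha> \<eta> \<Psi>))"
  using assms(3)
proof (rule computable_let)
  obtain c where c: "\<And>xs \<alpha> \<eta> \<Psi>. length xs = n \<Longrightarrow>
      kleene c (arguments xs \<alpha> \<eta> \<Psi>) (B xs \<alpha> \<eta> \<Psi>)"
    using assms(1) by (rule computableE) blast
  obtain d where d: "\<And>ys \<alpha> \<eta> \<Psi>. length ys = Suc (Suc n) \<Longrightarrow>
      kleene d (arguments ys \<alpha> \<eta> \<Psi>) (D (hd ys) (hd (tl ys)) (tl (tl ys)) \<alpha> \<eta> \<Psi>)"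
    using assms(2) by (rule computableE) blast
  have rec: "kleene (list_encode [5, c, d]) (T0 x # arguments xs \<alpha> \<eta> \<Psi>)
      (rec_nat (B xs \<alpha> \<eta> \<Psi>) (\<lambda>x u. D x u xs \<alpha> \<eta> \<Psi>) x)" (is "kleene _ _ (?r x)")
    if len: "length xs = n" for x xs \<alpha> \<eta> \<Psi>
  proof (induction x)
    case 0
    show ?case by (auto intro: S5_0 c[OF len] simp del: list_encode.simps)
  next
    case (Suc x)
    have "kleene d (T0 x # T0 (?r x) # arguments xs \<alpha> \<eta> \<Psi>) (?r (Suc x))"
      using d[of "x # ?r x # xs"] len by (auto simp: arguments_Cons)
    with Suc show ?case by (rule S5_Suc)
  qed
  have "kleene (list_encode [5, c, d]) (arguments ys \<alpha> \<eta> \<Psi>)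
      (rec_nat (B (tl ys) \<alpha> \<eta> \<Psi>) (\<lambda>x u. D x u (tl ys) \<alpha> \<eta> \<Psi>) (hd ys))"
    if "length ys = Suc n" for ys \<alpha> \<eta> \<Psi>
    using that rec by (cases ys) (auto simp: arguments_Cons simp del: list_encode.simps)
  then show "computable (Suc n) (\<lambda>ys \<alpha> \<eta> \<Psi>.
      rec_nat (B (tl ys) \<alpha> \<eta> \<Psi>) (\<lambda>x u. D x u (tl ys) \<alpha> \<eta> \<Psi>) (hd ys))"
    by (rule computableI)
qed

section \<open>Evaluation of the given functions and functionals\<close>

lemma computable_\<alpha>:
  assumes "computable n F"
  shows "computable n (\<lambda>xs \<alpha> \<eta> \<Psi>. \<alpha> (F xs \<alpha> \<eta> \<Psi>))"
  using assms
proof (rule computable_let)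
  \<comment> \<open>S7 expects the function in front and its argument right behind. The argument is
    the first of \<open>Suc n\<close> numbers, so it suffices to carry \<open>\<alpha>\<close> over
    all of them.\<close>
  obtain e where e: "\<And>us b vs v. length us = Suc n \<Longrightarrow> length vs = 3 \<Longrightarrow>
      kleene (list_encode [7]) (b # us @ vs) v \<Longrightarrow> kleene e (us @ b # vs) v"
    by (rule kleene_move_front) blast
  have "kleene e (arguments ys \<alpha> \<eta> \<Psi>) (\<alpha> (hd ys))" if "length ys = Suc n" for ys \<alpha> \<eta> \<Psi>
    using that e[of "map T0 ys" "[T1 \<eta>, T2 \<Psi>, T2 exists2]" "T1 \<alpha>"]
    by (cases ys) (auto simp: arguments_def intro: S7 simp del: list_encode.simps)
  then show "computable (Suc n) (\<lambda>ys \<alpha> \<eta> \<Psi>. \<alpha> (hd ys))" by (rule computableI)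
qed

lemma computable_\<eta>:
  assumes "computable n F"
  shows "computable n (\<lambda>xs \<alpha> \<eta> \<Psi>. \<eta> (F xs \<alpha> \<eta> \<Psi>))"
  using assms
proof (rule computable_let)
  obtain e where e: "\<And>us b vs v. length us = n + 2 \<Longrightarrow> length vs = 2 \<Longrightarrow>
      kleene (list_encode [7]) (b # us @ vs) v \<Longrightarrow> kleene e (us @ b # vs) v"
    by (rule kleene_move_front) blast
  have "kleene e (arguments ys \<alpha> \<eta> \<Psi>) (\<eta> (hd ys))" if "length ys = Suc n" for ys \<alpha> \<eta> \<Psi>
    using that e[of "map T0 ys @ [T1 \<alpha>]" "[T2 \<Psi>, T2 exists2]" "T1 \<eta>"]
    by (cases ys) (auto simp: arguments_def intro: S7 simp del: list_encode.simps)
  then show "computable (Suc n) (\<lambda>ys \<alpha> \<eta> \<Psi>. \<eta> (hd ys))" by (rule computableI)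
qed

text \<open>
  S8 wants the type-2 argument in front and then passes it on in second position, behind the new
  number; the argument list has to be rearranged before and after.
\<close>

lemma kleene_apply_type2:
  obtains e' where "\<And>us vs G g. length us = i \<Longrightarrow> length vs = j \<Longrightarrow>
    (\<And>t. kleene e (T0 t # us @ T2 G # vs) (g t)) \<Longrightarrow> kleene e' (us @ T2 G # vs) (G g)"
proof -
  \<comment> \<open>The index \<open>e1\<close> expects the functional in front, \<open>e2\<close>
    expects it behind the new number as S8 demands, and \<open>e3\<close> returns it to its own
    place in the list.\<close>
  obtain e1 where e1: "\<And>us b vs v. length us = Suc i \<Longrightarrow> length vs = j \<Longrightarrow>
      kleene e (us @ b # vs) v \<Longrightarrow> kleene e1 (b # us @ vs) v"
    by (rule kleene_move_back) blast
  obtain e2 where e2: "\<And>us b vs v. length us = 1 \<Longrightarrow> length vs = i + j \<Longrightarrow>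
      kleene e1 (b # us @ vs) v \<Longrightarrow> kleene e2 (us @ b # vs) v"
    by (rule kleene_move_front) blast
  obtain e3 where e3: "\<And>us b vs v. length us = i \<Longrightarrow> length vs = j \<Longrightarrow>
      kleene (list_encode [8, e2]) (b # us @ vs) v \<Longrightarrow> kleene e3 (us @ b # vs) v"
    by (rule kleene_move_front) blast
  show thesis
  proof
    fix us vs :: "obj list" and G g
    assume len: "length us = i" "length vs = j"
      and e: "\<And>t. kleene e (T0 t # us @ T2 G # vs) (g t)"
    have "kleene e2 (T0 t # T2 G # us @ vs) (g t)" for t
      using e2[of "[T0 t]" "us @ vs" "T2 G"] e1[of "T0 t # us" vs "T2 G"] e[of t] len by simp
    then show "kleene e3 (us @ T2 G # vs) (G g)"
      using len by (intro e3 S8)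
  qed
qed

lemma computable_\<Psi>:
  assumes "computable (Suc n) (\<lambda>ys \<alpha> \<eta> \<Psi>. F (hd ys) (tl ys) \<alpha> \<eta> \<Psi>)"
  shows "computable n (\<lambda>xs \<alpha> \<eta> \<Psi>. \<Psi> (\<lambda>t. F t xs \<alpha> \<eta> \<Psi>))"
proof -
  obtain d where d: "\<And>ys \<alpha> \<eta> \<Psi>. length ys = Suc n \<Longrightarrow>
      kleene d (arguments ys \<alpha> \<eta> \<Psi>) (F (hd ys) (tl ys) \<alpha> \<eta> \<Psi>)"
    using assms by (rule computableE) blast
  obtain e where e: "\<And>us vs G g. length us = n + 2 \<Longrightarrow> length vs = 1 \<Longrightarrow>
      (\<And>t. kleene d (T0 t # us @ T2 G # vs) (g t)) \<Longrightarrow> kleene e (us @ T2 G # vs) (G g)"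
    by (rule kleene_apply_type2) blast
  have "kleene e (arguments xs \<alpha> \<eta> \<Psi>) (\<Psi> (\<lambda>t. F t xs \<alpha> \<eta> \<Psi>))" if "length xs = n" for xs \<alpha> \<eta> \<Psi>
    using e[of "map T0 xs @ [T1 \<alpha>, T1 \<eta>]" "[T2 exists2]" \<Psi> "\<lambda>t. F t xs \<alpha> \<eta> \<Psi>"]
      d[of "t # xs" \<alpha> \<eta> \<Psi> for t] that
    by (simp add: arguments_def)
  then show ?thesis by (rule computableI)
qed

lemma computable_exists2:
  assumes "computable (Suc n) (\<lambda>ys \<alpha> \<eta> \<Psi>. F (hd ys) (tl ys) \<alpha> \<eta> \<Psi>)"
  shows "computable n (\<lambda>xs \<alpha> \<eta> \<Psi>. exists2 (\<lambda>t. F t xs \<alpha> \<eta> \<Psi>))"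
proof -
  obtain d where d: "\<And>ys \<alpha> \<eta> \<Psi>. length ys = Suc n \<Longrightarrow>
      kleene d (arguments ys \<alpha> \<eta> \<Psi>) (F (hd ys) (tl ys) \<alpha> \<eta> \<Psi>)"
    using assms by (rule computableE) blast
  obtain e where e: "\<And>us vs G g. length us = n + 3 \<Longrightarrow> length vs = 0 \<Longrightarrow>
      (\<And>t. kleene d (T0 t # us @ T2 G # vs) (g t)) \<Longrightarrow> kleene e (us @ T2 G # vs) (G g)"
    by (rule kleene_apply_type2) blast
  have "kleene e (arguments xs \<alpha> \<eta> \<Psi>) (exists2 (\<lambda>t. F t xs \<alpha> \<eta> \<Psi>))" if "length xs = n" for xs \<alpha> \<eta> \<Psi>
    using e[of "map T0 xs @ [T1 \<alpha>, T1 \<eta>, T2 \<Psi>]" "[]" exists2 "\<lambda>t. F t xs \<alpha> \<eta> \<Psi>"]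
      d[of "t # xs" \<alpha> \<eta> \<Psi> for t] that
    by (simp add: arguments_def)
  then show ?thesis by (rule computableI)
qed

section \<open>Arithmetical predicates are decidable\<close>

text \<open>Truth is coded by 0, so that \<open>exists2\<close> maps the characteristic function of
  a predicate to that of its existential quantification.\<close>

definition decidable :: "nat \<Rightarrow> bool functional \<Rightarrow> bool" where
  "decidable n P \<longleftrightarrow> computable n (\<lambda>xs \<alpha> \<eta> \<Psi>. if P xs \<alpha> \<eta> \<Psi> then 0 else 1)"

text \<open>The code of \<open>P\<close> is the length of a recursion: with 0 steps the base value
  \<open>F\<close> remains, and one step replaces it by \<open>G\<close>.\<close>

lemma computable_if:
  assumes "decidable n P" and "computable n F" and "computable n G"
  shows "computable n (\<lambda>xs \<alpha> \<eta> \<Psi>. if P xs \<alpha> \<eta> \<Psi> then F xs \<alpha> \<eta> \<Psi> else G xs \<alpha> \<eta> \<Psi>)"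
proof -
  have "computable n (\<lambda>xs \<alpha> \<eta> \<Psi>.
      rec_nat (F xs \<alpha> \<eta> \<Psi>) (\<lambda>x u. G xs \<alpha> \<eta> \<Psi>) (if P xs \<alpha> \<eta> \<Psi> then 0 else 1))"
    using assms unfolding decidable_def
    by (intro computable_rec computable_weaken) auto
  also have "(\<lambda>xs \<alpha> \<eta> \<Psi>.
      rec_nat (F xs \<alpha> \<eta> \<Psi>) (\<lambda>x u. G xs \<alpha> \<eta> \<Psi>) (if P xs \<alpha> \<eta> \<Psi> then 0 else 1)) =
      (\<lambda>xs \<alpha> \<eta> \<Psi>. if P xs \<alpha> \<eta> \<Psi> then F xs \<alpha> \<eta> \<Psi> else G xs \<alpha> \<eta> \<Psi>)"
    by (intro ext) simp
  finally show ?thesis .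
qed

text \<open>At \<open>Suc u\<close> the last recursion step has counter \<open>u\<close>, so a step
  that ignores the previous value sees just the predecessor.\<close>

lemma computable_case:
  assumes "computable n A"
    and "computable (Suc n) (\<lambda>ys \<alpha> \<eta> \<Psi>. F (hd ys) (tl ys) \<alpha> \<eta> \<Psi>)"
    and "computable n T"
  shows "computable n (\<lambda>xs \<alpha> \<eta> \<Psi>.
    case_nat (A xs \<alpha> \<eta> \<Psi>) (\<lambda>u. F u xs \<alpha> \<eta> \<Psi>) (T xs \<alpha> \<eta> \<Psi>))"
proof -
  have "computable n (\<lambda>xs \<alpha> \<eta> \<Psi>.
      rec_nat (A xs \<alpha> \<eta> \<Psi>) (\<lambda>x u. F x xs \<alpha> \<eta> \<Psi>) (T xs \<alpha> \<eta> \<Psi>))"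
    using assms by (intro computable_rec computable_drop_second)
  also have "(\<lambda>xs \<alpha> \<eta> \<Psi>. rec_nat (A xs \<alpha> \<eta> \<Psi>) (\<lambda>x u. F x xs \<alpha> \<eta> \<Psi>) (T xs \<alpha> \<eta> \<Psi>)) =
      (\<lambda>xs \<alpha> \<eta> \<Psi>. case_nat (A xs \<alpha> \<eta> \<Psi>) (\<lambda>u. F u xs \<alpha> \<eta> \<Psi>) (T xs \<alpha> \<eta> \<Psi>))"
    by (intro ext) (simp split: nat.split)
  finally show ?thesis .
qed

section \<open>Sums, products and powers\<close>

lemma computable_add:
  assumes "computable n F" and "computable n G"
  shows "computable n (\<lambda>xs \<alpha> \<eta> \<Psi>. F xs \<alpha> \<eta> \<Psi> + G xs \<alpha> \<eta> \<Psi>)"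
proof -
  have rec: "a + b = rec_nat a (\<lambda>x u. Suc u) b" for a b :: nat
    by (induction b) auto
  show ?thesis
    unfolding rec
    by (intro computable_rec computable_Suc computable_hd assms
        computable_weaken[where F = "\<lambda>xs \<alpha> \<eta> \<Psi>. hd xs"])
qed

lemma computable_mult:
  assumes "computable n F" and "computable n G"
  shows "computable n (\<lambda>xs \<alpha> \<eta> \<Psi>. F xs \<alpha> \<eta> \<Psi> * G xs \<alpha> \<eta> \<Psi>)"
proof -
  have rec: "a * b = rec_nat 0 (\<lambda>x u. u + a) b" for a b :: nat
    by (induction b) auto
  show ?thesis
    unfolding rec
    by (intro computable_rec computable_const computable_add computable_hd assms
        computable_weaken[where F = "\<lambda>xs \<alpha> \<eta> \<Psi>. hd xs"]
        computable_weaken[where F = "\<lambda>ys. F (tl ys)"] computable_weaken[where F = F])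
qed

lemma computable_power:
  assumes "computable n F" and "computable n G"
  shows "computable n (\<lambda>xs \<alpha> \<eta> \<Psi>. F xs \<alpha> \<eta> \<Psi> ^ G xs \<alpha> \<eta> \<Psi>)"
proof -
  have rec: "a ^ b = rec_nat 1 (\<lambda>x u. u * a) b" for a b :: nat
    by (induction b) auto
  show ?thesis
    unfolding rec
    by (intro computable_rec computable_const computable_mult computable_hd assms
        computable_weaken[where F = "\<lambda>xs \<alpha> \<eta> \<Psi>. hd xs"]
        computable_weaken[where F = "\<lambda>ys. F (tl ys)"] computable_weaken[where F = F])
qed

section \<open>Quantifiers and connectives\<close>

lemma decidable_Ex:
  assumes "decidable (Suc n) (\<lambda>ys \<alpha> \<eta> \<Psi>. P (hd ys) (tl ys) \<alpha> \<eta> \<Psi>)"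
  shows "decidable n (\<lambda>xs \<alpha> \<eta> \<Psi>. \<exists>y. P y xs \<alpha> \<eta> \<Psi>)"
proof -
  have ex: "exists2 (\<lambda>y. if p y then 0 else 1) = (if \<exists>y. p y then 0 else 1)" for p
    unfolding exists2_def by (intro if_cong ex_cong1) auto
  show ?thesis
    using assms unfolding decidable_def ex[symmetric] by (rule computable_exists2)
qed

lemma decidable_conj:
  assumes "decidable n P" and "decidable n Q"
  shows "decidable n (\<lambda>xs \<alpha> \<eta> \<Psi>. P xs \<alpha> \<eta> \<Psi> \<and> Q xs \<alpha> \<eta> \<Psi>)"
proof -
  have "computable n (\<lambda>xs \<alpha> \<eta> \<Psi>.
      if P xs \<alpha> \<eta> \<Psi> then if Q xs \<alpha> \<eta> \<Psi> then 0 else 1 else 1)"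
    using assms by (intro computable_if computable_const)
  also have "(\<lambda>xs \<alpha> \<eta> \<Psi>. if P xs \<alpha> \<eta> \<Psi> then if Q xs \<alpha> \<eta> \<Psi> then 0 else 1 else 1) =
      (\<lambda>xs \<alpha> \<eta> \<Psi>. if P xs \<alpha> \<eta> \<Psi> \<and> Q xs \<alpha> \<eta> \<Psi> then 0 else 1 :: nat)"
    by (intro ext) simp
  finally show ?thesis by (simp add: decidable_def)
qed

lemma decidable_Not:
  assumes "decidable n P"
  shows "decidable n (\<lambda>xs \<alpha> \<eta> \<Psi>. \<not> P xs \<alpha> \<eta> \<Psi>)"
proof -
  have "computable n (\<lambda>xs \<alpha> \<eta> \<Psi>. if P xs \<alpha> \<eta> \<Psi> then 1 else 0)"
    using assms by (intro computable_if computable_const)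
  also have "(\<lambda>xs \<alpha> \<eta> \<Psi>. if P xs \<alpha> \<eta> \<Psi> then 1 else 0) =
      (\<lambda>xs \<alpha> \<eta> \<Psi>. if \<not> P xs \<alpha> \<eta> \<Psi> then 0 else 1 :: nat)"
    by (intro ext) simp
  finally show ?thesis by (simp add: decidable_def)
qed

lemma decidable_imp:
  assumes "decidable n P" and "decidable n Q"
  shows "decidable n (\<lambda>xs \<alpha> \<eta> \<Psi>. P xs \<alpha> \<eta> \<Psi> \<longrightarrow> Q xs \<alpha> \<eta> \<Psi>)"
  using decidable_Not[OF decidable_conj[OF assms(1) decidable_Not[OF assms(2)]]] by simp

lemma decidable_All:
  assumes "decidable (Suc n) (\<lambda>ys \<alpha> \<eta> \<Psi>. P (hd ys) (tl ys) \<alpha> \<eta> \<Psi>)"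
  shows "decidable n (\<lambda>xs \<alpha> \<eta> \<Psi>. \<forall>y. P y xs \<alpha> \<eta> \<Psi>)"
  using decidable_Not[OF decidable_Ex[OF decidable_Not[OF assms]]] by simp

lemma decidable_drop_second:
  assumes "decidable (Suc n) (\<lambda>ys \<alpha> \<eta> \<Psi>. P (hd ys) (tl ys) \<alpha> \<eta> \<Psi>)"
  shows "decidable (Suc (Suc n)) (\<lambda>ys \<alpha> \<eta> \<Psi>. P (hd ys) (tl (tl ys)) \<alpha> \<eta> \<Psi>)"
  using assms unfolding decidable_def by (rule computable_drop_second)

section \<open>Truncated subtraction and comparison of numbers\<close>

lemma computable_diff:
  assumes "computable n F" and "computable n G"
  shows "computable n (\<lambda>xs \<alpha> \<eta> \<Psi>. F xs \<alpha> \<eta> \<Psi> - G xs \<alpha> \<eta> \<Psi>)"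
proof -
  have pred: "a - 1 = rec_nat 0 (\<lambda>x u. x) a" for a :: nat
    by (cases a) auto
  have rec: "a - b = rec_nat a (\<lambda>x u. rec_nat 0 (\<lambda>y v. y) u) b" for a b :: nat
    by (induction b) (auto simp flip: pred)
  show ?thesis
    unfolding rec
    by (intro computable_rec computable_const computable_hd assms
        computable_weaken[where F = "\<lambda>xs \<alpha> \<eta> \<Psi>. hd xs"])
qed

lemma decidable_eq_0:
  assumes "computable n F"
  shows "decidable n (\<lambda>xs \<alpha> \<eta> \<Psi>. F xs \<alpha> \<eta> \<Psi> = 0)"
proof -
  have rec: "(if a = 0 then 0 else 1) = rec_nat 0 (\<lambda>x u. 1) a" for a :: nat
    by (cases a) auto
  show ?thesis
    unfolding decidable_def rec by (intro computable_rec computable_const assms)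
qed

lemma decidable_le:
  assumes "computable n F" and "computable n G"
  shows "decidable n (\<lambda>xs \<alpha> \<eta> \<Psi>. F xs \<alpha> \<eta> \<Psi> \<le> G xs \<alpha> \<eta> \<Psi>)"
  using decidable_eq_0[OF computable_diff[OF assms]] by simp

lemma decidable_less:
  assumes "computable n F" and "computable n G"
  shows "decidable n (\<lambda>xs \<alpha> \<eta> \<Psi>. F xs \<alpha> \<eta> \<Psi> < G xs \<alpha> \<eta> \<Psi>)"
  using decidable_le[OF computable_Suc[OF assms(1)] assms(2)] by (simp add: Suc_le_eq)

lemma decidable_eq:
  assumes "computable n F" and "computable n G"
  shows "decidable n (\<lambda>xs \<alpha> \<eta> \<Psi>. F xs \<alpha> \<eta> \<Psi> = G xs \<alpha> \<eta> \<Psi>)"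
  using decidable_conj[OF decidable_le[OF assms] decidable_le[OF assms(2,1)]]
  by (simp add: order_eq_iff)

text \<open>Projections to variables bound further outside. Depth 6 is reached in
  \<open>good_radius_code\<close>, where \<open>k\<close> is read underneath \<open>N\<close>,
  \<open>M\<close>, \<open>m\<close>, \<open>j\<close>, \<open>c\<close> and the index
  \<open>i\<close> of a sequence.\<close>

lemmas computable_tl =
  computable_hd[THEN computable_weaken]
  computable_hd[THEN computable_weaken, THEN computable_weaken]
  computable_hd[THEN computable_weaken, THEN computable_weaken, THEN computable_weaken]
  computable_hd[THEN computable_weaken, THEN computable_weaken, THEN computable_weaken,
    THEN computable_weaken]
  computable_hd[THEN computable_weaken, THEN computable_weaken, THEN computable_weaken,
    THEN computable_weaken, THEN computable_weaken]
  computable_hd[THEN computable_weaken, THEN computable_weaken, THEN computable_weaken,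
    THEN computable_weaken, THEN computable_weaken, THEN computable_weaken]

lemmas computable_intros =
  computable_const computable_hd computable_tl computable_Suc computable_add computable_mult
  computable_power computable_diff computable_\<alpha> computable_\<eta> computable_\<Psi> computable_case
  computable_if
  decidable_Ex decidable_All decidable_conj decidable_imp decidable_Not decidable_le
  decidable_less decidable_eq

text \<open>A recursion over the bound changes its value only at the first hit; that no smaller
  number is a hit is decided by \<open>exists2\<close>. With \<open>F\<close> applied inside, a
  failed search returns 0 itself and not \<open>F\<close> of a default value.\<close>

lemma computable_least:
  assumes P: "decidable (Suc n) (\<lambda>ys \<alpha> \<eta> \<Psi>. P (hd ys) (tl ys) \<alpha> \<eta> \<Psi>)"
    and F: "computable (Suc n) (\<lambda>ys \<alpha> \<eta> \<Psi>. F (hd ys) (tl ys) \<alpha> \<eta> \<Psi>)"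
    and B: "computable n B"
  shows "computable n (\<lambda>xs \<alpha> \<eta> \<Psi>.
    if \<exists>i<B xs \<alpha> \<eta> \<Psi>. P i xs \<alpha> \<eta> \<Psi> then F (LEAST i. P i xs \<alpha> \<eta> \<Psi>) xs \<alpha> \<eta> \<Psi> else 0)"
proof -
  have rec: "(if \<exists>i<b. p i then f (LEAST i. p i) else 0) =
      rec_nat 0 (\<lambda>i u. if p i \<and> (\<forall>j. j < i \<longrightarrow> \<not> p j) then f i else u) b"
    for p and f :: "nat \<Rightarrow> nat" and b
  proof (induction b)
    case (Suc b)
    have "(LEAST i. p i) = b" if "p b" "\<forall>j. j < b \<longrightarrow> \<not> p j"
      using that by (intro Least_equality) (auto simp: not_less[symmetric])
    with Suc show ?case
      by (cases "\<exists>i<b. p i") (auto simp: less_Suc_eq)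
  qed simp
  have eq: "(if \<exists>i<B xs \<alpha> \<eta> \<Psi>. P i xs \<alpha> \<eta> \<Psi> then F (LEAST i. P i xs \<alpha> \<eta> \<Psi>) xs \<alpha> \<eta> \<Psi> else 0) =
      rec_nat 0 (\<lambda>i u. if P i xs \<alpha> \<eta> \<Psi> \<and> (\<forall>j. j < i \<longrightarrow> \<not> P j xs \<alpha> \<eta> \<Psi>)
        then F i xs \<alpha> \<eta> \<Psi> else u) (B xs \<alpha> \<eta> \<Psi>)" for xs \<alpha> \<eta> \<Psi>
    by (rule rec[of _ "\<lambda>i. P i xs \<alpha> \<eta> \<Psi>" "\<lambda>i. F i xs \<alpha> \<eta> \<Psi>"])
  show ?thesis
    unfolding eq
    by (intro computable_rec computable_intros computable_drop_second[of _ F] F B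
        decidable_drop_second[of _ P] P decidable_drop_second[where P = 
          "\<lambda>i xs \<alpha> \<eta> \<Psi>. P i xs \<alpha> \<eta> \<Psi> \<and> (\<forall>j. j < i \<longrightarrow> \<not> P j xs \<alpha> \<eta> \<Psi>)"]
        computable_weaken[where F = "\<lambda>xs \<alpha> \<eta> \<Psi>. hd xs"])
qed


section \<open>Halving and the pairing function\<close>

lemma computable_div2:
  assumes "computable n F"
  shows "computable n (\<lambda>xs \<alpha> \<eta> \<Psi>. F xs \<alpha> \<eta> \<Psi> div 2)"
proof -
  \<comment> \<open>Halving becomes a bounded search for the first \<open>i\<close> with
    \<open>a < 2 * i + 2\<close>. Already \<open>i = a\<close> satisfies this, so the search below
    \<open>Suc a\<close> never fails.\<close>
  have "(LEAST i. a < 2 * i + 2) = a div 2" and "\<exists>i<Suc a. a < 2 * i + 2" for a :: nat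
    by (rule Least_equality) auto
  then have div: "a div 2 =
      (if \<exists>i<Suc a. a < 2 * i + 2 then (LEAST i. a < 2 * i + 2) else 0)" for a :: nat
    by simp
  show ?thesis
    unfolding div
    by (intro computable_least computable_intros computable_weaken[where F = F] assms)
qed

lemma decidable_even:
  assumes "computable n F"
  shows "decidable n (\<lambda>xs \<alpha> \<eta> \<Psi>. even (F xs \<alpha> \<eta> \<Psi>))"
proof -
  have even: "even a \<longleftrightarrow> a = 2 * (a div 2)" for a :: nat
    by presburger
  show ?thesis
    by (subst even) (intro decidable_eq computable_mult computable_const computable_div2 assms)
qed

lemma computable_prod_encode:
  assumes "computable n F" and "computable n G"
  shows "computable n (\<lambda>xs \<alpha> \<eta> \<Psi>. prod_encode (F xs \<alpha> \<eta> \<Psi>, G xs \<alpha> \<eta> \<Psi>))"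
  unfolding prod_encode_def triangle_def prod.case
  by (intro computable_intros computable_div2 assms)

text \<open>A pair code bounds both components, so each is found by a search below
  \<open>Suc a\<close>, with the other supplied by an unbounded quantifier.\<close>

lemma computable_prod_decode:
  assumes "computable n F"
  shows "computable n (\<lambda>xs \<alpha> \<eta> \<Psi>. fst (prod_decode (F xs \<alpha> \<eta> \<Psi>)))"
    and "computable n (\<lambda>xs \<alpha> \<eta> \<Psi>. snd (prod_decode (F xs \<alpha> \<eta> \<Psi>)))"
proof -
  have enc: "prod_encode (x, y) = a \<longleftrightarrow> x = fst (prod_decode a) \<and> y = snd (prod_decode a)" for x y a
    by (metis prod.collapse prod_decode_inverse prod_encode_inverse fst_conv snd_conv)
  have le: "fst (prod_decode a) < Suc a" "snd (prod_decode a) < Suc a" for a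
    by (metis le_prod_encode_1 le_prod_encode_2 less_Suc_eq_le prod.collapse prod_decode_inverse)+
  have fst: "fst (prod_decode a) = (if \<exists>x<Suc a. \<exists>y. prod_encode (x, y) = a
      then (LEAST x. \<exists>y. prod_encode (x, y) = a) else 0)" for a
    unfolding enc using le by (auto intro: Least_equality[symmetric])
  have snd: "snd (prod_decode a) = (if \<exists>y<Suc a. \<exists>x. prod_encode (x, y) = a
      then (LEAST y. \<exists>x. prod_encode (x, y) = a) else 0)" for a
    unfolding enc using le by (auto intro: Least_equality[symmetric])
  show "computable n (\<lambda>xs \<alpha> \<eta> \<Psi>. fst (prod_decode (F xs \<alpha> \<eta> \<Psi>)))"
    unfolding fst by (intro computable_least computable_intros computable_prod_encode
        computable_weaken[where F = F] computable_weaken[where F = "\<lambda>ys. F (tl ys)"] assms)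
  show "computable n (\<lambda>xs \<alpha> \<eta> \<Psi>. snd (prod_decode (F xs \<alpha> \<eta> \<Psi>)))"
    unfolding snd by (intro computable_least computable_intros computable_prod_encode
        computable_weaken[where F = F] computable_weaken[where F = "\<lambda>ys. F (tl ys)"] assms)
qed

section \<open>Rational-valued functionals\<close>

text \<open>Computed values are natural numbers. The difference accounts for signs, and the positive
  denominator reduces the comparison of rationals to that of natural numbers.\<close>

definition rational_computable :: "nat \<Rightarrow> real functional \<Rightarrow> bool" where
  "rational_computable n X \<longleftrightarrow> (\<exists>A B C. computable n A \<and> computable n B \<and> computable n C \<and>
     (\<forall>xs \<alpha> \<eta> \<Psi>. C xs \<alpha> \<eta> \<Psi> > 0 \<and>
       X xs \<alpha> \<eta> \<Psi> = (real (A xs \<alpha> \<eta> \<Psi>) - real (B xs \<alpha> \<eta> \<Psi>)) / real (C xs \<alpha> \<eta> \<Psi>)))"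

lemma rational_computableI:
  assumes "computable n A" and "computable n B" and "computable n C"
    and "\<And>xs \<alpha> \<eta> \<Psi>. C xs \<alpha> \<eta> \<Psi> > 0"
    and "\<And>xs \<alpha> \<eta> \<Psi>.
      X xs \<alpha> \<eta> \<Psi> = (real (A xs \<alpha> \<eta> \<Psi>) - real (B xs \<alpha> \<eta> \<Psi>)) / real (C xs \<alpha> \<eta> \<Psi>)"
  shows "rational_computable n X"
  using assms unfolding rational_computable_def by blast

lemma rational_computableE:
  assumes "rational_computable n X"
  obtains A B C where "computable n A" and "computable n B" and "computable n C"
    and "\<And>xs \<alpha> \<eta> \<Psi>. C xs \<alpha> \<eta> \<Psi> > 0"
    and "\<And>xs \<alpha> \<eta> \<Psi>.
      X xs \<alpha> \<eta> \<Psi> = (real (A xs \<alpha> \<eta> \<Psi>) - real (B xs \<alpha> \<eta> \<Psi>)) / real (C xs \<alpha> \<eta> \<Psi>)"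
  using assms unfolding rational_computable_def by blast

lemma rational_computable_of_nat:
  assumes "computable n F"
  shows "rational_computable n (\<lambda>xs \<alpha> \<eta> \<Psi>. real (F xs \<alpha> \<eta> \<Psi>))"
  by (rule rational_computableI[OF assms computable_const[where c = 0] computable_const[where c = 1]])
    auto

lemma rational_computable_minus:
  assumes "rational_computable n X"
  shows "rational_computable n (\<lambda>xs \<alpha> \<eta> \<Psi>. - X xs \<alpha> \<eta> \<Psi>)"
proof -
  obtain A B C where A: "computable n A" and B: "computable n B" and C: "computable n C"
    and pos: "\<And>xs \<alpha> \<eta> \<Psi>. C xs \<alpha> \<eta> \<Psi> > 0"
    and X: "\<And>xs \<alpha> \<eta> \<Psi>.
      X xs \<alpha> \<eta> \<Psi> = (real (A xs \<alpha> \<eta> \<Psi>) - real (B xs \<alpha> \<eta> \<Psi>)) / real (C xs \<alpha> \<eta> \<Psi>)"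
    using assms by (rule rational_computableE) blast
  show ?thesis
    by (rule rational_computableI[OF B A C pos]) (simp add: X minus_divide_left)
qed

lemma rational_computable_add:
  assumes "rational_computable n X" and "rational_computable n Y"
  shows "rational_computable n (\<lambda>xs \<alpha> \<eta> \<Psi>. X xs \<alpha> \<eta> \<Psi> + Y xs \<alpha> \<eta> \<Psi>)"
proof -
  obtain A B C where A: "computable n A" and B: "computable n B" and C: "computable n C"
    and pos: "\<And>xs \<alpha> \<eta> \<Psi>. C xs \<alpha> \<eta> \<Psi> > 0"
    and X: "\<And>xs \<alpha> \<eta> \<Psi>.
      X xs \<alpha> \<eta> \<Psi> = (real (A xs \<alpha> \<eta> \<Psi>) - real (B xs \<alpha> \<eta> \<Psi>)) / real (C xs \<alpha> \<eta> \<Psi>)"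
    using assms(1) by (rule rational_computableE) blast
  obtain A' B' C' where A': "computable n A'" and B': "computable n B'" and C': "computable n C'"
    and pos': "\<And>xs \<alpha> \<eta> \<Psi>. C' xs \<alpha> \<eta> \<Psi> > 0"
    and Y: "\<And>xs \<alpha> \<eta> \<Psi>.
      Y xs \<alpha> \<eta> \<Psi> = (real (A' xs \<alpha> \<eta> \<Psi>) - real (B' xs \<alpha> \<eta> \<Psi>)) / real (C' xs \<alpha> \<eta> \<Psi>)"
    using assms(2) by (rule rational_computableE) blast
  show ?thesis
  proof (rule rational_computableI)
    show "computable n (\<lambda>xs \<alpha> \<eta> \<Psi>.
        A xs \<alpha> \<eta> \<Psi> * C' xs \<alpha> \<eta> \<Psi> + A' xs \<alpha> \<eta> \<Psi> * C xs \<alpha> \<eta> \<Psi>)"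
      by (intro computable_add computable_mult A A' C C')
    show "computable n (\<lambda>xs \<alpha> \<eta> \<Psi>.
        B xs \<alpha> \<eta> \<Psi> * C' xs \<alpha> \<eta> \<Psi> + B' xs \<alpha> \<eta> \<Psi> * C xs \<alpha> \<eta> \<Psi>)"
      by (intro computable_add computable_mult B B' C C')
    show "computable n (\<lambda>xs \<alpha> \<eta> \<Psi>. C xs \<alpha> \<eta> \<Psi> * C' xs \<alpha> \<eta> \<Psi>)"
      by (intro computable_mult C C')
    fix xs \<alpha> \<eta> \<Psi>
    have nz: "real (C xs \<alpha> \<eta> \<Psi>) \<noteq> 0" "real (C' xs \<alpha> \<eta> \<Psi>) \<noteq> 0"
      using pos pos' by (simp_all add: less_imp_neq[symmetric])
    show "C xs \<alpha> \<eta> \<Psi> * C' xs \<alpha> \<eta> \<Psi> > 0"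
      using pos pos' by simp
    show "X xs \<alpha> \<eta> \<Psi> + Y xs \<alpha> \<eta> \<Psi> =
        (real (A xs \<alpha> \<eta> \<Psi> * C' xs \<alpha> \<eta> \<Psi> + A' xs \<alpha> \<eta> \<Psi> * C xs \<alpha> \<eta> \<Psi>) -
         real (B xs \<alpha> \<eta> \<Psi> * C' xs \<alpha> \<eta> \<Psi> + B' xs \<alpha> \<eta> \<Psi> * C xs \<alpha> \<eta> \<Psi>)) /
        real (C xs \<alpha> \<eta> \<Psi> * C' xs \<alpha> \<eta> \<Psi>)"
      unfolding X Y add_frac_eq[OF nz] by (simp add: algebra_simps)
  qed
qed

lemma rational_computable_diff:
  assumes "rational_computable n X" and "rational_computable n Y"
  shows "rational_computable n (\<lambda>xs \<alpha> \<eta> \<Psi>. X xs \<alpha> \<eta> \<Psi> - Y xs \<alpha> \<eta> \<Psi>)"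
  using rational_computable_add[OF assms(1) rational_computable_minus[OF assms(2)]] by simp

lemma rational_computable_divide:
  assumes "rational_computable n X" and D: "computable n D"
  shows "rational_computable n (\<lambda>xs \<alpha> \<eta> \<Psi>. X xs \<alpha> \<eta> \<Psi> / real (D xs \<alpha> \<eta> \<Psi>))"
proof -
  obtain A B C where A: "computable n A" and B: "computable n B" and C: "computable n C"
    and pos: "\<And>xs \<alpha> \<eta> \<Psi>. C xs \<alpha> \<eta> \<Psi> > 0"
    and X: "\<And>xs \<alpha> \<eta> \<Psi>.
      X xs \<alpha> \<eta> \<Psi> = (real (A xs \<alpha> \<eta> \<Psi>) - real (B xs \<alpha> \<eta> \<Psi>)) / real (C xs \<alpha> \<eta> \<Psi>)"
    using assms(1) by (rule rational_computableE) blast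
  show ?thesis
  proof (rule rational_computableI)
    \<comment> \<open>Division by 0 yields 0. The fraction 0 / 1 takes its place, so that the
      denominator stays positive.\<close>
    show "computable n (\<lambda>xs \<alpha> \<eta> \<Psi>. if D xs \<alpha> \<eta> \<Psi> = 0 then 0 else A xs \<alpha> \<eta> \<Psi>)"
      by (intro computable_intros A D)
    show "computable n (\<lambda>xs \<alpha> \<eta> \<Psi>. if D xs \<alpha> \<eta> \<Psi> = 0 then 0 else B xs \<alpha> \<eta> \<Psi>)"
      by (intro computable_intros B D)
    show "computable n (\<lambda>xs \<alpha> \<eta> \<Psi>. if D xs \<alpha> \<eta> \<Psi> = 0 then 1 else C xs \<alpha> \<eta> \<Psi> * D xs \<alpha> \<eta> \<Psi>)"
      by (intro computable_intros C D)
  qed (use pos in \<open>auto simp: X\<close>)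
qed

lemma rational_computable_if:
  assumes P: "decidable n P" and "rational_computable n X" and "rational_computable n Y"
  shows "rational_computable n
    (\<lambda>xs \<alpha> \<eta> \<Psi>. if P xs \<alpha> \<eta> \<Psi> then X xs \<alpha> \<eta> \<Psi> else Y xs \<alpha> \<eta> \<Psi>)"
proof -
  obtain A B C where A: "computable n A" and B: "computable n B" and C: "computable n C"
    and pos: "\<And>xs \<alpha> \<eta> \<Psi>. C xs \<alpha> \<eta> \<Psi> > 0"
    and X: "\<And>xs \<alpha> \<eta> \<Psi>.
      X xs \<alpha> \<eta> \<Psi> = (real (A xs \<alpha> \<eta> \<Psi>) - real (B xs \<alpha> \<eta> \<Psi>)) / real (C xs \<alpha> \<eta> \<Psi>)"
    using assms(2) by (rule rational_computableE) blast
  obtain A' B' C' where A': "computable n A'" and B': "computable n B'" and C': "computable n C'"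
    and pos': "\<And>xs \<alpha> \<eta> \<Psi>. C' xs \<alpha> \<eta> \<Psi> > 0"
    and Y: "\<And>xs \<alpha> \<eta> \<Psi>.
      Y xs \<alpha> \<eta> \<Psi> = (real (A' xs \<alpha> \<eta> \<Psi>) - real (B' xs \<alpha> \<eta> \<Psi>)) / real (C' xs \<alpha> \<eta> \<Psi>)"
    using assms(3) by (rule rational_computableE) blast
  show ?thesis
    by (rule rational_computableI[OF computable_if[OF P A A'] computable_if[OF P B B']
          computable_if[OF P C C']]) (use pos pos' in \<open>auto simp: X Y\<close>)
qed

lemma decidable_rational_less:
  assumes "rational_computable n X" and "rational_computable n Y"
  shows "decidable n (\<lambda>xs \<alpha> \<eta> \<Psi>. X xs \<alpha> \<eta> \<Psi> < Y xs \<alpha> \<eta> \<Psi>)"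
proof -
  obtain A B C where A: "computable n A" and B: "computable n B" and C: "computable n C"
    and pos: "\<And>xs \<alpha> \<eta> \<Psi>. C xs \<alpha> \<eta> \<Psi> > 0"
    and XY: "\<And>xs \<alpha> \<eta> \<Psi>. X xs \<alpha> \<eta> \<Psi> - Y xs \<alpha> \<eta> \<Psi> =
      (real (A xs \<alpha> \<eta> \<Psi>) - real (B xs \<alpha> \<eta> \<Psi>)) / real (C xs \<alpha> \<eta> \<Psi>)"
    using rational_computable_diff[OF assms] by (rule rational_computableE) blast
  have "X xs \<alpha> \<eta> \<Psi> < Y xs \<alpha> \<eta> \<Psi> \<longleftrightarrow> A xs \<alpha> \<eta> \<Psi> < B xs \<alpha> \<eta> \<Psi>" for xs \<alpha> \<eta> \<Psi>
    using XY[of xs \<alpha> \<eta> \<Psi>] pos[of xs \<alpha> \<eta> \<Psi>]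
    by (simp add: less_iff_diff_less_0[of "X xs \<alpha> \<eta> \<Psi>"] divide_less_0_iff)
  then show ?thesis using decidable_less[OF A B] by simp
qed

lemma rational_computable_abs:
  assumes "rational_computable n X"
  shows "rational_computable n (\<lambda>xs \<alpha> \<eta> \<Psi>. \<bar>X xs \<alpha> \<eta> \<Psi>\<bar>)"
  unfolding abs_if
  using rational_computable_of_nat[OF computable_const[where c = 0]] assms
  by (intro rational_computable_if decidable_rational_less rational_computable_minus) auto

abbreviation rational_of :: "nat \<Rightarrow> real" where
  "rational_of a \<equiv> real_of_rat (nat_to_rat_surj a)"

text \<open>Integers are coded by parity: \<open>2 * m\<close> stands for \<open>m\<close> and
  \<open>2 * m + 1\<close> for \<open>- (m + 1)\<close>. The sign of a negative denominator moves to
  the numerator, which leaves divisions by natural numbers as in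
  \<open>rational_computable_divide\<close>.\<close>

lemma rational_of_eq:
  "rational_of a = (let s = fst (prod_decode a); t = snd (prod_decode a);
     p = (if even s then real (s div 2) else - real (s div 2 + 1))
   in if even t then p / real (t div 2) else - p / real (t div 2 + 1))"
proof -
  have int: "real_of_int (int_decode s) =
      (if even s then real (s div 2) else - real (s div 2 + 1))" for s
    by (simp add: int_decode_def sum_decode_def)
  \<comment> \<open>\<open>Fract p 0\<close> is 0, and so is a real quotient by 0; codes with
    denominator 0 are therefore covered.\<close>
  have "real_of_rat (Fract p q) = real_of_int p / real_of_int q" for p q
    by (cases "q = 0") (simp_all add: of_rat_rat rat_number_collapse)
  then have "rational_of a =
      real_of_int (int_decode (fst (prod_decode a))) / real_of_int (int_decode (snd (prod_decode a)))"
    by (simp add: nat_to_rat_surj_def case_prod_beta)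
  then show ?thesis
    unfolding int Let_def by (simp only: divide_minus_right minus_divide_left split: if_split) blast
qed

lemma rational_computable_rational_of:
  assumes "computable n F"
  shows "rational_computable n (\<lambda>xs \<alpha> \<eta> \<Psi>. rational_of (F xs \<alpha> \<eta> \<Psi>))"
  unfolding rational_of_eq Let_def
  by (intro rational_computable_if rational_computable_divide rational_computable_minus
      rational_computable_of_nat decidable_even computable_div2 computable_add computable_const
      computable_prod_decode assms)

lemma rational_computable_drop_second:
  assumes "rational_computable (Suc n) (\<lambda>ys \<alpha> \<eta> \<Psi>. X (hd ys) (tl ys) \<alpha> \<eta> \<Psi>)"
  shows "rational_computable (Suc (Suc n)) (\<lambda>ys \<alpha> \<eta> \<Psi>. X (hd ys) (tl (tl ys)) \<alpha> \<eta> \<Psi>)"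
proof -
  obtain A B C where A: "computable (Suc n) A" and B: "computable (Suc n) B"
    and C: "computable (Suc n) C" and pos: "\<And>ys \<alpha> \<eta> \<Psi>. C ys \<alpha> \<eta> \<Psi> > 0"
    and X: "\<And>ys \<alpha> \<eta> \<Psi>. X (hd ys) (tl ys) \<alpha> \<eta> \<Psi> =
      (real (A ys \<alpha> \<eta> \<Psi>) - real (B ys \<alpha> \<eta> \<Psi>)) / real (C ys \<alpha> \<eta> \<Psi>)"
    using assms by (rule rational_computableE) blast
  \<comment> \<open>\<open>A\<close>, \<open>B\<close> and \<open>C\<close> do not come in the form
    with \<open>hd\<close> and \<open>tl\<close>, but \<open>F ys\<close> equals
    \<open>F (hd ys # tl ys)\<close> on the nonempty lists that matter here.\<close>
  have drop: "computable (Suc (Suc n)) (\<lambda>ys. F (hd ys # tl (tl ys)))"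
    if F: "computable (Suc n) F" for F
  proof (rule computable_drop_second[where F = "\<lambda>x xs. F (x # xs)"])
    show "computable (Suc n) (\<lambda>ys \<alpha> \<eta> \<Psi>. F (hd ys # tl ys) \<alpha> \<eta> \<Psi>)"
    proof -
      obtain e where "\<And>ys \<alpha> \<eta> \<Psi>. length ys = Suc n \<Longrightarrow>
          kleene e (arguments ys \<alpha> \<eta> \<Psi>) (F ys \<alpha> \<eta> \<Psi>)"
        using F by (rule computableE) blast
      then show ?thesis
        by (intro computableI[of _ e]) (metis list.collapse list.size(3) nat.simps(3))
    qed
  qed
  show ?thesis
    by (rule rational_computableI[OF drop[OF A] drop[OF B] drop[OF C] pos])
      (use X[of "_ # _"] in simp)
qed

section \<open>Comparison of limits\<close>

text \<open>A strict inequality of limits without a rate of convergence: from some stage on, the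
  terms keep a fixed positive distance. Only number quantifiers over rational comparisons occur,
  which \<open>exists2\<close> can decide.\<close>

definition limit_less :: "(nat \<Rightarrow> real) \<Rightarrow> (nat \<Rightarrow> real) \<Rightarrow> bool" where
  "limit_less s t \<longleftrightarrow> (\<exists>j i. \<forall>m. i \<le> m \<longrightarrow> s m + 1 / real (Suc j) < t m)"

lemma limit_less_iff:
  assumes s: "s \<longlonglongrightarrow> x" and t: "t \<longlonglongrightarrow> y"
  shows "limit_less s t \<longleftrightarrow> x < y"
proof
  assume "limit_less s t"
  then obtain j i where "\<And>m. i \<le> m \<Longrightarrow> s m + 1 / real (Suc j) < t m"
    unfolding limit_less_def by blast
  then have "x + 1 / real (Suc j) \<le> y"
    by (intro LIMSEQ_le[OF tendsto_add[OF s tendsto_const] t]) (auto intro: less_imp_le)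
  moreover have "1 / real (Suc j) > 0" by simp
  ultimately show "x < y" by linarith
next
  assume "x < y"
  then obtain j where j: "1 / real (Suc j) < y - x"
    using reals_Archimedean[of "y - x"] by (auto simp: inverse_eq_divide)
  have "(\<lambda>m. t m - s m) \<longlonglongrightarrow> y - x"
    by (intro tendsto_diff s t)
  then have "\<forall>\<^sub>F m in sequentially. 1 / real (Suc j) < t m - s m"
    using j by (rule order_tendstoD)
  then show "limit_less s t"
    by (force simp: limit_less_def eventually_sequentially algebra_simps)
qed

lemma decidable_limit_less:
  assumes "rational_computable (Suc n) (\<lambda>ys \<alpha> \<eta> \<Psi>. S (hd ys) (tl ys) \<alpha> \<eta> \<Psi>)"
    and "rational_computable (Suc n) (\<lambda>ys \<alpha> \<eta> \<Psi>. T (hd ys) (tl ys) \<alpha> \<eta> \<Psi>)"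
  shows "decidable n (\<lambda>xs \<alpha> \<eta> \<Psi>. limit_less (\<lambda>m. S m xs \<alpha> \<eta> \<Psi>) (\<lambda>m. T m xs \<alpha> \<eta> \<Psi>))"
proof -
  \<comment> \<open>The sequence index \<open>m\<close> is bound underneath \<open>i\<close> and
    \<open>j\<close>, which the terms of both sequences have to skip.\<close>
  have drop: "rational_computable (Suc (Suc (Suc n))) (\<lambda>ys \<alpha> \<eta> \<Psi>. X (hd ys) (tl (tl (tl ys))) \<alpha> \<eta> \<Psi>)"
    if "rational_computable (Suc n) (\<lambda>ys \<alpha> \<eta> \<Psi>. X (hd ys) (tl ys) \<alpha> \<eta> \<Psi>)" for X
    by (rule rational_computable_drop_second[where X = "\<lambda>x xs. X x (tl xs)",
          OF rational_computable_drop_second[OF that]])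
  have one: "1 = real 1" by simp
  show ?thesis
    unfolding limit_less_def
    by (subst one, intro decidable_Ex decidable_All decidable_imp decidable_le decidable_rational_less
        rational_computable_add rational_computable_divide rational_computable_of_nat
        drop[OF assms(1)] drop[OF assms(2)] computable_intros)
qed

section \<open>Representations\<close>

lemma real_rep_iff:
  "real_rep \<alpha> x \<longleftrightarrow>
     (\<forall>n i. \<bar>rational_of (\<alpha> n) - rational_of (\<alpha> (n + i))\<bar> < 1 / 2 ^ n) \<and>
     (\<lambda>n. rational_of (\<alpha> n)) \<longlonglongrightarrow> x"
proof -
  have "\<bar>p - q\<bar> < 1 / 2 ^ n \<longleftrightarrow> \<bar>real_of_rat p - real_of_rat q\<bar> < 1 / 2 ^ n" for p q n
    using of_rat_less[of "\<bar>p - q\<bar>" "1 / 2 ^ n", where 'a = real]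
    by (simp add: of_rat_divide of_rat_power flip: of_rat_diff)
  then show ?thesis by (simp add: real_rep_def)
qed

text \<open>With it, a quantifier over rational points becomes a quantifier over codes, each
  evaluated at a constant sequence.\<close>

lemma real_rep_const: "real_rep (\<lambda>_. c) (rational_of c)"
  by (simp add: real_rep_iff)

text \<open>The even numbers 2 and \<open>2 * 2 ^ l\<close> code the integers 1 and
  \<open>2 ^ l\<close>.\<close>

definition dyadic_code :: "nat \<Rightarrow> nat" where
  "dyadic_code l = prod_encode (2, 2 * 2 ^ l)"

lemma rational_of_dyadic_code: "rational_of (dyadic_code l) = 1 / 2 ^ l"
  by (simp add: rational_of_eq dyadic_code_def Let_def)

text \<open>The code 0 stands for 0 divided by 0, which is 0. So the value of a failed search in
  \<open>computable_least\<close> codes the rational 0.\<close>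

lemma rational_of_0: "rational_of 0 = 0"
  by (simp add: rational_of_eq Let_def prod_decode_def prod_decode_aux.simps)

text \<open>The sequence jumps at most once, from 0 to its final value. If the entry at stage
  \<open>n\<close> is still 0, then \<open>l\<close> is at least \<open>n + 2\<close>, so the jump
  is smaller than \<open>1 / 2 ^ n\<close>.\<close>

lemma real_rep_dyadic:
  "real_rep (\<lambda>k. if l < k + 2 then dyadic_code l else 0) (1 / 2 ^ l)"
proof -
  have of: "rational_of (if b then dyadic_code l else 0) = (if b then 1 / 2 ^ l else 0)" for b
    by (simp add: rational_of_dyadic_code rational_of_0)
  have "1 / 2 ^ l < (1 / 2 ^ n :: real)" if "\<not> l < n + 2" for n
  proof -
    have "(2 :: real) ^ n < 2 ^ l" using that by (intro power_strict_increasing) auto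
    then show ?thesis by (simp add: field_simps)
  qed
  then have "\<bar>rational_of (if l < n + 2 then dyadic_code l else 0) -
      rational_of (if l < n + i + 2 then dyadic_code l else 0)\<bar> < 1 / 2 ^ n" for n i
    unfolding of by (cases "l < n + 2") auto
  moreover have "\<forall>\<^sub>F k in sequentially. rational_of (if l < k + 2 then dyadic_code l else 0) = 1 / 2 ^ l"
    using eventually_ge_at_top[of l] by eventually_elim (simp add: rational_of_dyadic_code)
  ultimately show ?thesis
    unfolding real_rep_iff by (auto intro: tendsto_eventually)
qed

definition approximants :: "((nat \<Rightarrow> nat) \<Rightarrow> nat) \<Rightarrow> nat \<Rightarrow> (nat \<Rightarrow> nat) \<Rightarrow> nat \<Rightarrow> real" where
  "approximants \<Psi> m \<alpha> i = rational_of (\<Psi> (case_nat (prod_encode (m, i)) \<alpha>))"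

lemma approximants_tendsto:
  assumes "seq_rep \<Psi> fs" and "real_rep \<alpha> x"
  shows "approximants \<Psi> m \<alpha> \<longlonglongrightarrow> fs m x"
  using assms by (auto simp: seq_rep_def fun_rep_def real_rep_iff approximants_def[abs_def])

section \<open>The gauge\<close>

text \<open>The second condition excludes each smaller stage on the whole ball. One \<open>m\<close>
  and one margin \<open>1 / real (Suc j)\<close> serve all rational points, so by continuity the
  inequality extends to every point of the ball and still contradicts the bound
  \<open>\<epsilon> / 4\<close> there.\<close>

definition good_radius :: "(nat \<Rightarrow> real \<Rightarrow> real) \<Rightarrow> real \<Rightarrow> real \<Rightarrow> nat \<Rightarrow> bool" where
  "good_radius fs \<epsilon> x k \<longleftrightarrow> (\<exists>N.
     (\<forall>m\<ge>N. \<bar>fs m x - fs N x\<bar> \<le> \<epsilon> / 4) \<and>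
     (\<forall>M<N. \<exists>m\<ge>M. \<exists>j. \<forall>q\<in>\<rat>. \<bar>x - q\<bar> < 1 / 2 ^ k \<longrightarrow>
        \<epsilon> / 4 + 1 / real (Suc j) \<le> \<bar>fs m q - fs M q\<bar>) \<and>
     (\<forall>q\<in>\<rat>. \<bar>x - q\<bar> < 1 / 2 ^ k \<longrightarrow> \<bar>fs N q - fs N x\<bar> \<le> \<epsilon> / 4))"

definition gauge_of :: "(nat \<Rightarrow> real \<Rightarrow> real) \<Rightarrow> real \<Rightarrow> real \<Rightarrow> real" where
  "gauge_of fs \<epsilon> x = 1 / 2 ^ (LEAST k. good_radius fs \<epsilon> x k)"

section \<open>Existence of good radii and the gauge property\<close>

lemma continuous_ge_from_rationals:
  fixes g :: "real \<Rightarrow> real"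
  assumes g: "continuous_on UNIV g"
    and ge: "\<And>q. q \<in> \<rat> \<Longrightarrow> \<bar>x - q\<bar> < r \<Longrightarrow> c \<le> g q"
    and y: "\<bar>x - y\<bar> < r"
  shows "c \<le> g y"
proof (rule ccontr)
  assume "\<not> c \<le> g y"
  \<comment> \<open>A violation at \<open>y\<close> would spread to an open set inside the ball, and
    thus to a rational point.\<close>
  define U where "U = {z. g z < c} \<inter> {z. \<bar>x - z\<bar> < r}"
  have "open U"
    unfolding U_def using g by (intro open_Int open_Collect_less continuous_intros)
  moreover have "y \<in> U"
    using \<open>\<not> c \<le> g y\<close> y by (simp add: U_def)
  ultimately obtain e where e: "e > 0" "\<And>z. dist z y < e \<Longrightarrow> z \<in> U"
    unfolding open_dist by blast
  obtain q where "q \<in> \<rat>" "y < q" "q < y + e"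
    using Rats_dense_in_real[of y "y + e"] e(1) by auto
  then have "q \<in> U" by (intro e(2)) (simp add: dist_real_def)
  then show False using ge[OF \<open>q \<in> \<rat>\<close>] by (simp add: U_def)
qed

lemma good_radius_exists:
  assumes cont: "\<And>n. continuous_on UNIV (fs n)"
    and lim: "(\<lambda>n. fs n x) \<longlonglongrightarrow> L" and "\<epsilon> > 0"
  shows "\<exists>k. good_radius fs \<epsilon> x k"
proof -
  define A where "A N \<longleftrightarrow> (\<forall>m\<ge>N. \<bar>fs m x - fs N x\<bar> \<le> \<epsilon> / 4)" for N
  have "Cauchy (\<lambda>n. fs n x)"
    using lim by (simp add: LIMSEQ_imp_Cauchy)
  then obtain N0 where "\<And>m n. m \<ge> N0 \<Longrightarrow> n \<ge> N0 \<Longrightarrow> \<bar>fs m x - fs n x\<bar> < \<epsilon> / 4"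
    using \<open>\<epsilon> > 0\<close> unfolding Cauchy_def dist_real_def by (meson divide_pos_pos zero_less_numeral)
  then have "A N0" unfolding A_def by (auto intro: less_imp_le)
  \<comment> \<open>The least settled stage is taken, so that every smaller stage fails at
    \<open>x\<close> by a strict inequality, which continuity spreads to a ball.\<close>
  define N where "N = (LEAST N. A N)"
  have N: "A N" unfolding N_def using \<open>A N0\<close> by (rule LeastI)
  have not_A: "\<not> A M" if "M < N" for M
    using that unfolding N_def by (rule not_less_Least)
  have isCont: "isCont (fs n) x" for n
    using cont by (simp add: continuous_on_eq_continuous_at)
  \<comment> \<open>With each requirement valid for all large \<open>k\<close>, the finitely many of
    them, including one for each \<open>M < N\<close>, are met by a common radius.\<close>
  have near: "\<forall>\<^sub>F k in sequentially. \<forall>z. \<bar>x - z\<bar> < 1 / 2 ^ k \<longrightarrow> Q z"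
    if Q: "\<forall>\<^sub>F z in nhds x. Q z" for Q :: "real \<Rightarrow> bool"
  proof -
    obtain d where d: "d > 0" "\<And>z. dist z x < d \<Longrightarrow> Q z"
      using Q unfolding eventually_nhds_metric by blast
    have "(\<lambda>k. (1 / 2) ^ k :: real) \<longlonglongrightarrow> 0"
      by (intro LIMSEQ_realpow_zero) auto
    then have "\<forall>\<^sub>F k in sequentially. (1 / 2) ^ k < d"
      using d(1) by (rule order_tendstoD)
    then show ?thesis
      by eventually_elim (auto intro!: d(2) simp: dist_real_def power_one_over)
  qed
  have "\<forall>\<^sub>F k in sequentially. \<exists>m\<ge>M. \<exists>j. \<forall>q. \<bar>x - q\<bar> < 1 / 2 ^ k \<longrightarrow>
      \<epsilon> / 4 + 1 / real (Suc j) \<le> \<bar>fs m q - fs M q\<bar>" if M: "M < N" for M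
  proof -
    obtain m where m: "m \<ge> M" "\<epsilon> / 4 < \<bar>fs m x - fs M x\<bar>"
      using not_A[OF M] unfolding A_def by (auto simp: not_le)
    then obtain j where j: "1 / real (Suc j) < \<bar>fs m x - fs M x\<bar> - \<epsilon> / 4"
      using reals_Archimedean[of "\<bar>fs m x - fs M x\<bar> - \<epsilon> / 4"] by (auto simp: inverse_eq_divide)
    have "((\<lambda>z. \<bar>fs m z - fs M z\<bar>) \<longlongrightarrow> \<bar>fs m x - fs M x\<bar>) (nhds x)"
      using isCont by (intro tendsto_intros) (auto simp: tendsto_at_iff_tendsto_nhds isCont_def)
    then have "\<forall>\<^sub>F z in nhds x. \<epsilon> / 4 + 1 / real (Suc j) < \<bar>fs m z - fs M z\<bar>"
      using j by (intro order_tendstoD) auto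
    then have "\<forall>\<^sub>F z in nhds x. \<epsilon> / 4 + 1 / real (Suc j) \<le> \<bar>fs m z - fs M z\<bar>"
      by eventually_elim simp
    then have "\<forall>\<^sub>F k in sequentially. \<forall>z. \<bar>x - z\<bar> < 1 / 2 ^ k \<longrightarrow>
        \<epsilon> / 4 + 1 / real (Suc j) \<le> \<bar>fs m z - fs M z\<bar>"
      by (rule near)
    then show ?thesis
      by eventually_elim (use m in blast)
  qed
  then have "\<forall>\<^sub>F k in sequentially. \<forall>M\<in>{..<N}. \<exists>m\<ge>M. \<exists>j. \<forall>q. \<bar>x - q\<bar> < 1 / 2 ^ k \<longrightarrow>
      \<epsilon> / 4 + 1 / real (Suc j) \<le> \<bar>fs m q - fs M q\<bar>"
    by (intro eventually_ball_finite) auto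
  moreover have "\<forall>\<^sub>F k in sequentially. \<forall>q. \<bar>x - q\<bar> < 1 / 2 ^ k \<longrightarrow> \<bar>fs N q - fs N x\<bar> \<le> \<epsilon> / 4"
  proof (rule near)
    have "(fs N \<longlongrightarrow> fs N x) (nhds x)"
      using isCont by (simp add: tendsto_at_iff_tendsto_nhds isCont_def)
    then have "\<forall>\<^sub>F z in nhds x. dist (fs N z) (fs N x) < \<epsilon> / 4"
      using \<open>\<epsilon> > 0\<close> by (intro tendstoD) auto
    then show "\<forall>\<^sub>F z in nhds x. \<bar>fs N z - fs N x\<bar> \<le> \<epsilon> / 4"
      by eventually_elim (simp add: dist_real_def)
  qed
  ultimately have "\<forall>\<^sub>F k in sequentially. good_radius fs \<epsilon> x k"
  proof eventually_elim
    case (elim k)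
    then show ?case
      using N unfolding good_radius_def A_def by (intro exI[of _ N] conjI) blast+
  qed
  then show ?thesis
    by (auto simp: eventually_sequentially)
qed

lemma gauge_of_eps_gauge:
  assumes cont: "\<And>n. continuous_on UNIV (fs n)"
    and lim: "\<And>x. (\<lambda>n. fs n x) \<longlonglongrightarrow> f x" and "\<epsilon> > 0"
  shows "eps_gauge \<epsilon> f (gauge_of fs \<epsilon>)"
  unfolding eps_gauge_def
proof (intro conjI allI impI)
  show "gauge_of fs \<epsilon> x > 0" for x
    by (simp add: gauge_of_def)
  \<comment> \<open>The body of \<open>good_radius\<close> with \<open>N\<close> and the radius as
    parameters, so that the stages of two points can be compared.\<close>
  define stage where "stage x N r \<longleftrightarrow>
     (\<forall>m\<ge>N. \<bar>fs m x - fs N x\<bar> \<le> \<epsilon> / 4) \<and>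
     (\<forall>M<N. \<exists>m\<ge>M. \<exists>j. \<forall>q\<in>\<rat>. \<bar>x - q\<bar> < r \<longrightarrow>
        \<epsilon> / 4 + 1 / real (Suc j) \<le> \<bar>fs m q - fs M q\<bar>) \<and>
     (\<forall>q\<in>\<rat>. \<bar>x - q\<bar> < r \<longrightarrow> \<bar>fs N q - fs N x\<bar> \<le> \<epsilon> / 4)" for x N r
  have ex: "\<exists>N. stage x N (gauge_of fs \<epsilon> x)" for x
    using LeastI_ex[OF good_radius_exists[OF cont lim[of x] \<open>\<epsilon> > 0\<close>]]
    unfolding good_radius_def stage_def gauge_of_def .
  \<comment> \<open>If \<open>N < N'\<close>, the witness that rules out \<open>N\<close> around
    \<open>y\<close> also rules it out at \<open>x\<close>, which lies in that ball, although
    \<open>N\<close> is settled at \<open>x\<close>. Used in both directions, this makes the two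
    stages equal.\<close>
  have le: "N' \<le> N" if x: "stage x N r" and y: "stage y N' r'" and xy: "\<bar>y - x\<bar> < r'"
    for x y N N' r r'
  proof (rule ccontr)
    assume "\<not> N' \<le> N"
    then have "N < N'" by simp
    then obtain m j where m: "m \<ge> N" and
      q: "\<And>q. q \<in> \<rat> \<Longrightarrow> \<bar>y - q\<bar> < r' \<Longrightarrow> \<epsilon> / 4 + 1 / real (Suc j) \<le> \<bar>fs m q - fs N q\<bar>"
      using y unfolding stage_def by blast
    have "\<epsilon> / 4 + 1 / real (Suc j) \<le> \<bar>fs m x - fs N x\<bar>"
      by (rule continuous_ge_from_rationals[OF _ q xy]) (intro continuous_intros cont)
    moreover have "\<bar>fs m x - fs N x\<bar> \<le> \<epsilon> / 4"
      using x m unfolding stage_def by blast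
    moreover have "1 / real (Suc j) > 0" by simp
    ultimately show False by linarith
  qed
  fix x y
  assume xy: "\<bar>x - y\<bar> < min (gauge_of fs \<epsilon> x) (gauge_of fs \<epsilon> y)"
  obtain N where N: "stage x N (gauge_of fs \<epsilon> x)" using ex by blast
  obtain N' where N': "stage y N' (gauge_of fs \<epsilon> y)" using ex by blast
  have "N' = N"
    using le[OF N N'] le[OF N' N] xy by (auto simp: abs_minus_commute)
  have f: "\<bar>f z - fs N z\<bar> \<le> \<epsilon> / 4" if "stage z N r" for z r
  proof (rule LIMSEQ_le_const2)
    show "(\<lambda>n. \<bar>fs n z - fs N z\<bar>) \<longlonglongrightarrow> \<bar>f z - fs N z\<bar>"
      by (intro tendsto_intros lim)
    show "\<exists>i. \<forall>n\<ge>i. \<bar>fs n z - fs N z\<bar> \<le> \<epsilon> / 4"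
      using that unfolding stage_def by blast
  qed
  \<comment> \<open>Negation turns the upper bound on the variation of \<open>fs N\<close> into a
    lower bound, which \<open>continuous_ge_from_rationals\<close> can transport.\<close>
  have "- (\<epsilon> / 4) \<le> - \<bar>fs N y - fs N x\<bar>"
  proof (rule continuous_ge_from_rationals[where g = "\<lambda>z. - \<bar>fs N z - fs N x\<bar>"])
    show "continuous_on UNIV (\<lambda>z. - \<bar>fs N z - fs N x\<bar>)"
      by (intro continuous_intros cont)
    show "- (\<epsilon> / 4) \<le> - \<bar>fs N q - fs N x\<bar>" if "q \<in> \<rat>" "\<bar>x - q\<bar> < gauge_of fs \<epsilon> x" for q
      using N that unfolding stage_def by auto
    show "\<bar>x - y\<bar> < gauge_of fs \<epsilon> x" using xy by simp
  qed
  \<comment> \<open>Three errors of at most \<open>\<epsilon> / 4\<close> add up: from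
    \<open>f x\<close> to \<open>fs N x\<close>, on to \<open>fs N y\<close>, and from there to
    \<open>f y\<close>.\<close>
  then show "\<bar>f x - f y\<bar> < \<epsilon>"
    using f[OF N] f[OF N'[unfolded \<open>N' = N\<close>]] \<open>\<epsilon> > 0\<close> by linarith
qed

text \<open>
  On sequences that represent no real number this is still decidable but has no meaning.
\<close>

definition good_radius_code ::
  "(nat \<Rightarrow> nat) \<Rightarrow> (nat \<Rightarrow> nat) \<Rightarrow> ((nat \<Rightarrow> nat) \<Rightarrow> nat) \<Rightarrow> nat \<Rightarrow> bool" where
  "good_radius_code \<alpha> \<eta> \<Psi> k \<longleftrightarrow> (\<exists>N.
     (\<forall>m. N \<le> m \<longrightarrow> \<not> limit_less (\<lambda>i. rational_of (\<eta> i) / real 4)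
        (\<lambda>i. \<bar>approximants \<Psi> m \<alpha> i - approximants \<Psi> N \<alpha> i\<bar>)) \<and>
     (\<forall>M. M < N \<longrightarrow> (\<exists>m. M \<le> m \<and> (\<exists>j. \<forall>c.
        limit_less (\<lambda>i. \<bar>rational_of (\<alpha> i) - rational_of c\<bar>) (\<lambda>i. real 1 / real (2 ^ k)) \<longrightarrow>
        \<not> limit_less (\<lambda>i. \<bar>approximants \<Psi> m (\<lambda>_. c) i - approximants \<Psi> M (\<lambda>_. c) i\<bar>)
          (\<lambda>i. rational_of (\<eta> i) / real 4 + real 1 / real (Suc j))))) \<and>
     (\<forall>c. limit_less (\<lambda>i. \<bar>rational_of (\<alpha> i) - rational_of c\<bar>) (\<lambda>i. real 1 / real (2 ^ k)) \<longrightarrow>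
        \<not> limit_less (\<lambda>i. rational_of (\<eta> i) / real 4)
          (\<lambda>i. \<bar>approximants \<Psi> N (\<lambda>_. c) i - approximants \<Psi> N \<alpha> i\<bar>)))"

text \<open>On representations both sequences in each \<open>limit_less\<close> converge, so it
  compares their limits. A non-strict inequality appears as the negation of the reversed strict
  one.\<close>

lemma good_radius_code_iff:
  assumes \<Psi>: "seq_rep \<Psi> fs" and \<eta>: "real_rep \<eta> \<epsilon>" and \<alpha>: "real_rep \<alpha> x"
  shows "good_radius_code \<alpha> \<eta> \<Psi> k \<longleftrightarrow> good_radius fs \<epsilon> x k"
proof -
  note lim = approximants_tendsto[OF \<Psi> \<alpha>] approximants_tendsto[OF \<Psi> real_rep_const]
    \<alpha>[unfolded real_rep_iff, THEN conjunct2] \<eta>[unfolded real_rep_iff, THEN conjunct2]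
  have settled: "limit_less (\<lambda>i. rational_of (\<eta> i) / real 4)
        (\<lambda>i. \<bar>approximants \<Psi> m \<alpha> i - approximants \<Psi> N \<alpha> i\<bar>) \<longleftrightarrow> \<epsilon> / 4 < \<bar>fs m x - fs N x\<bar>" for m N
    by (rule limit_less_iff) (auto intro!: tendsto_intros lim)
  have near: "limit_less (\<lambda>i. \<bar>rational_of (\<alpha> i) - rational_of c\<bar>) (\<lambda>i. real 1 / real (2 ^ k)) \<longleftrightarrow>
      \<bar>x - rational_of c\<bar> < 1 / 2 ^ k" for c
    by (rule limit_less_iff) (auto intro!: tendsto_intros lim)
  have unsettled: "limit_less (\<lambda>i. \<bar>approximants \<Psi> m (\<lambda>_. c) i - approximants \<Psi> M (\<lambda>_. c) i\<bar>)
      (\<lambda>i. rational_of (\<eta> i) / real 4 + real 1 / real (Suc j)) \<longleftrightarrow>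
      \<bar>fs m (rational_of c) - fs M (rational_of c)\<bar> < \<epsilon> / 4 + 1 / real (Suc j)" for m M c j
    by (rule limit_less_iff) (auto intro!: tendsto_intros lim)
  have cont: "limit_less (\<lambda>i. rational_of (\<eta> i) / real 4)
      (\<lambda>i. \<bar>approximants \<Psi> N (\<lambda>_. c) i - approximants \<Psi> N \<alpha> i\<bar>) \<longleftrightarrow>
      \<epsilon> / 4 < \<bar>fs N (rational_of c) - fs N x\<bar>" for N c
    by (rule limit_less_iff) (auto intro!: tendsto_intros lim)
  have rats: "(\<forall>q\<in>\<rat>. Q q) \<longleftrightarrow> (\<forall>c. Q (rational_of c))" for Q :: "real \<Rightarrow> bool"
    by (auto simp: Rats_eq_range_of_rat_o_nat_to_rat_surj)
  show ?thesis
    unfolding good_radius_code_def good_radius_def settled near unsettled cont rats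
    by (simp only: not_less)
qed

section \<open>Decidability of the radius condition\<close>

lemma rational_computable_approximants:
  assumes "computable n F" and "computable n I"
    and "computable (Suc n) (\<lambda>ys \<alpha> \<eta> \<Psi>. A (tl ys) \<alpha> \<eta> \<Psi> (hd ys))"
  shows "rational_computable n (\<lambda>xs \<alpha> \<eta> \<Psi>. approximants \<Psi> (F xs \<alpha> \<eta> \<Psi>) (A xs \<alpha> \<eta> \<Psi>) (I xs \<alpha> \<eta> \<Psi>))"
proof -
  \<comment> \<open>The sequence handed to \<open>\<Psi>\<close> starts with the code of function
    and position, so its entry at \<open>t\<close> is found by cases on \<open>t\<close>. Since
    \<open>A\<close> may depend on the context, both \<open>\<alpha>\<close> and constant sequences
    are covered.\<close>
  have "computable n (\<lambda>xs \<alpha> \<eta> \<Psi>. \<Psi> (\<lambda>t. case_nat (prod_encode (F xs \<alpha> \<eta> \<Psi>, I xs \<alpha> \<eta> \<Psi>))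
      (\<lambda>u. A xs \<alpha> \<eta> \<Psi> u) t))"
    by (intro computable_\<Psi> computable_case computable_prod_encode computable_hd
        computable_weaken[where F = F] computable_weaken[where F = I] assms
        computable_drop_second[where F = "\<lambda>x xs \<alpha> \<eta> \<Psi>. A xs \<alpha> \<eta> \<Psi> x"])
  then show ?thesis
    unfolding approximants_def by (rule rational_computable_rational_of)
qed

lemma decidable_good_radius_code:
  "decidable (Suc n) (\<lambda>ys \<alpha> \<eta> \<Psi>. good_radius_code \<alpha> \<eta> \<Psi> (hd ys))"
  unfolding good_radius_code_def
  by (intro decidable_limit_less rational_computable_approximants rational_computable_abs
      rational_computable_add rational_computable_diff rational_computable_divide
      rational_computable_of_nat rational_computable_rational_of computable_intros)

theorem theorem2p7:
  shows "\<exists>e. \<forall>(fs :: nat \<Rightarrow> real \<Rightarrow> real) (f :: real \<Rightarrow> real).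
    (\<forall>n. continuous_on UNIV (fs n)) \<longrightarrow>
    (\<forall>x. (\<lambda>n. fs n x) \<longlonglongrightarrow> f x) \<longrightarrow>
    (\<exists>\<Delta>. gauge_representation f \<Delta> \<and> exists2_computes_from e fs \<Delta>)"
proof -
  \<comment> \<open>The search bound \<open>k + 2\<close> and the default 0 reproduce the sequence
    of \<open>real_rep_dyadic\<close>, with the least good exponent as \<open>l\<close>.\<close>
  define \<Phi> where "\<Phi> \<alpha> \<eta> \<Psi> k = (if \<exists>i<k + 2. good_radius_code \<alpha> \<eta> \<Psi> i
    then dyadic_code (LEAST i. good_radius_code \<alpha> \<eta> \<Psi> i) else 0)" for \<alpha> \<eta> \<Psi> k
  have "computable (Suc 0) (\<lambda>xs \<alpha> \<eta> \<Psi>. \<Phi> \<alpha> \<eta> \<Psi> (hd xs))"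
    unfolding \<Phi>_def dyadic_code_def
    by (intro computable_least[where P = "\<lambda>i xs \<alpha> \<eta> \<Psi>. good_radius_code \<alpha> \<eta> \<Psi> i"
          and F = "\<lambda>i xs \<alpha> \<eta> \<Psi>. prod_encode (2, 2 * 2 ^ i)"]
        decidable_good_radius_code computable_intros computable_prod_encode)
  \<comment> \<open>The index is obtained before any sequence of functions is fixed and is therefore
    uniform in \<open>fs\<close>.\<close>
  then obtain e where "\<And>xs \<alpha> \<eta> \<Psi>. length xs = Suc 0 \<Longrightarrow>
      kleene e (arguments xs \<alpha> \<eta> \<Psi>) (\<Phi> \<alpha> \<eta> \<Psi> (hd xs))"
    by (rule computableE) blast
  from this[of "[_]"]
  have e: "kleene e [T0 k, T1 \<alpha>, T1 \<eta>, T2 \<Psi>, T2 exists2] (\<Phi> \<alpha> \<eta> \<Psi> k)" for k \<alpha> \<eta> \<Psi>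
    by (simp add: arguments_def)
  show ?thesis
  proof (intro exI[of _ e] allI impI)
    fix fs :: "nat \<Rightarrow> real \<Rightarrow> real" and f
    assume cont: "\<forall>n. continuous_on UNIV (fs n)" and lim: "\<forall>x. (\<lambda>n. fs n x) \<longlonglongrightarrow> f x"
    have "gauge_representation f (gauge_of fs)"
      using cont lim by (auto simp: gauge_representation_def intro!: gauge_of_eps_gauge)
    moreover have "fun_rep (\<lambda>\<alpha> k. \<Phi> \<alpha> \<eta> \<Psi> k) (gauge_of fs \<epsilon>)"
      if \<Psi>: "seq_rep \<Psi> fs" and "\<epsilon> > 0" and \<eta>: "real_rep \<eta> \<epsilon>" for \<Psi> \<epsilon> \<eta>
      unfolding fun_rep_def
    proof (intro allI impI)
      fix \<alpha> x
      assume \<alpha>: "real_rep \<alpha> x"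
      let ?l = "LEAST k. good_radius fs \<epsilon> x k"
      have "\<exists>k. good_radius fs \<epsilon> x k"
        using cont lim \<open>\<epsilon> > 0\<close> by (intro good_radius_exists) auto
      \<comment> \<open>As some good exponent exists, the search below \<open>k + 2\<close> succeeds
        exactly when the least one lies below that bound.\<close>
      then have "(\<exists>i<k + 2. good_radius fs \<epsilon> x i) \<longleftrightarrow> ?l < k + 2" for k
        by (meson LeastI_ex Least_le le_less_trans)
      \<comment> \<open>The right-hand side mentions only the represented reals and functions, so
        the exponent found does not depend on the chosen representations.\<close>
      moreover have "good_radius_code \<alpha> \<eta> \<Psi> = good_radius fs \<epsilon> x"
        by (intro ext good_radius_code_iff \<Psi> \<eta> \<alpha>)
      ultimately show "real_rep (\<lambda>k. \<Phi> \<alpha> \<eta> \<Psi> k) (gauge_of fs \<epsilon> x)"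
        using real_rep_dyadic[of ?l] by (simp add: \<Phi>_def gauge_of_def cong: if_cong)
    qed
    ultimately show "\<exists>\<Delta>. gauge_representation f \<Delta> \<and> exists2_computes_from e fs \<Delta>"
      unfolding exists2_computes_from_def using e by blast
  qed
qed

end
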